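(* Let $n\geq 1$ be an integer. (i) The distribution of $A_n[\infty]$ is mixing with respect to vertical translations, i.e. $$\lim_{|k|\rightarrow\infty}\mathbb{P}\big(A_n[\infty]\in \mathcal{A},\ A_n[\infty]\in \tau_k\mathcal{B}\big) = \mathbb{P}\big(A_n[\infty]\in \mathcal{A}\big)\,\mathbb{P}\big(A_n[\infty]\in \mathcal{B}\big)$$ for any events $\mathcal{A}, \mathcal{B}$. (ii) The same holds for $A_n^\ast[\infty]$ and for $A_n^\dag[\infty]$.
   Context: Let $(S_{i,j})_{i\in\mathbb{Z},j\geq1}$ be independent simple symmetric random walks on $\mathbb{Z}^2$, $S_{i,j}$ starting at $(0,i)$. When the current aggregate is $A\subset\mathbb{Z}^2$, sending particle $(i,j)$ (from level $i$) means: follow $S_{i,j}$ until the first time (possibly time $0$) it is at a site $z\notin A$; the particle stops there and the aggregate becomes $A\cup\{z\}$. $A_n[M]$ ($M\geq0$) is the aggregate obtained from $\emptyset$ by sending $n$ particles from each level $i$ with $|i|\le M$, levels being treated in the usual order $0,1,-1,2,-2,\dots,M,-M$; $A_n[\infty]=\bigcup_{M\geq0}A_n[M]$ (increasing union). Let $(N_i)_{i\in\mathbb{Z}}$ be i.i.d. Poisson random variables with parameter $n$, independent of the walks. $A_n^*[M]$ is obtained in the same usual order but sending $N_i$ particles from level $i$; $A_n^*[\infty]=\bigcup_{M\geq0}A_n^*[M]$. Let $(\mathcal{N}_i)_{i\in\mathbb{Z}}$ be i.i.d. Poisson point processes on $\mathbb{R}^+$ with intensity $1$, independent of the walks, and let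 $T_{i,1}<T_{i,2}<\dots$ be the points of $\mathcal{N}_i$. $A_n^\dag[M]$ is the aggregate obtained from $\emptyset$ by sending, in increasing order of the times $T_{i,j}$ (a.s. distinct), all particles $(i,j)$ with $|i|\leq M$ and $T_{i,j}\leq n$ (trajectories are realized instantaneously); $A_n^\dag[\infty]=\bigcup_{M\geq0}A_n^\dag[M]$. For $k\in\mathbb{Z}$, $\tau_k$ denotes the translation by the vector $(0,k)$. Events $\mathcal{A},\mathcal{B}$ are measurable sets of subsets of $\mathbb{Z}^2$ (product $\sigma$-algebra), and $\tau_k\mathcal{B}=\{\tau_kC: C\in\mathcal{B}\}$. *)

theory Defs
  imports "HOL-Probability.Probability"
begin

section \<open>Random inputs\<close>

type_synonym site = "int \<times> int"

definition path_space :: "(nat \<Rightarrow> site) measure" where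
  "path_space = PiM UNIV (\<lambda>_. count_space UNIV)"

definition simple_random_walk :: "'a measure \<Rightarrow> site \<Rightarrow> ('a \<Rightarrow> nat \<Rightarrow> site) \<Rightarrow> bool" where
  "simple_random_walk M x X \<longleftrightarrow>
     (\<forall>\<omega>\<in>space M. X \<omega> 0 = x) \<and>
     prob_space.indep_vars M (\<lambda>_. count_space UNIV) (\<lambda>t \<omega>. X \<omega> (Suc t) - X \<omega> t) UNIV \<and>
     (\<forall>t. distr M (count_space UNIV) (\<lambda>\<omega>. X \<omega> (Suc t) - X \<omega> t)
        = measure_pmf (pmf_of_set {(1, 0), (-1, 0), (0, 1), (0, -1)}))"

text \<open>Independence of two families as wholes (each may have dependencies within itself, and the
  value spaces may have different types).\<close>

definition indep_families ::
  "'a measure \<Rightarrow> 'i set \<Rightarrow> ('i \<Rightarrow> 'a \<Rightarrow> 'b) \<Rightarrow> 'b measure \<Rightarrow>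
     'j set \<Rightarrow> ('j \<Rightarrow> 'a \<Rightarrow> 'c) \<Rightarrow> 'c measure \<Rightarrow> bool" where
  "indep_families M I X K J Y L \<longleftrightarrow>
     prob_space.indep_set M
       (sets (vimage_algebra (space M) (\<lambda>\<omega>. \<lambda>i\<in>I. X i \<omega>) (PiM I (\<lambda>_. K))))
       (sets (vimage_algebra (space M) (\<lambda>\<omega>. \<lambda>j\<in>J. Y j \<omega>) (PiM J (\<lambda>_. L))))"

text \<open>The indices \<open>j\<close> of the particles at a level start at 1; \<open>S i 0\<close> is never used.\<close>

definition particle_indices :: "(int \<times> nat) set" where
  "particle_indices = UNIV \<times> {1..}"

definition independent_walks :: "'a measure \<Rightarrow> (int \<Rightarrow> nat \<Rightarrow> 'a \<Rightarrow> nat \<Rightarrow> site) \<Rightarrow> bool" where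
  "independent_walks M S \<longleftrightarrow>
     (\<forall>(i, j)\<in>particle_indices. simple_random_walk M (0, i) (S i j)) \<and>
     prob_space.indep_vars M (\<lambda>_. path_space) (\<lambda>(i, j). S i j) particle_indices"

definition iid_poisson :: "'a measure \<Rightarrow> real \<Rightarrow> (int \<Rightarrow> 'a \<Rightarrow> nat) \<Rightarrow> bool" where
  "iid_poisson M r N \<longleftrightarrow>
     prob_space.indep_vars M (\<lambda>_. count_space UNIV) N UNIV \<and>
     (\<forall>i. distr M (count_space UNIV) (N i) = measure_pmf (poisson_pmf r))"

text \<open>The intensity measure below is diffuse, so a Poisson point process is simple and is
  represented by its (locally finite) random set of points.\<close>

definition locally_finite :: "real set set" where
  "locally_finite = {C. C \<subseteq> {0..} \<and> (\<forall>t. finite (C \<inter> {..t}))}"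

definition bounded_borel :: "real set set" where
  "bounded_borel = {B \<in> sets borel. bounded B \<and> B \<subseteq> {0..}}"

definition point_space :: "real set measure" where
  "point_space = sigma locally_finite
     {{C \<in> locally_finite. card (C \<inter> B) = k} | B k. B \<in> bounded_borel}"

text \<open>The Poisson weights are written out because \<open>poisson_pmf\<close> requires a positive
  rate, whereas \<open>B\<close> may be a null set.\<close>

definition poisson_process :: "'a measure \<Rightarrow> real \<Rightarrow> ('a \<Rightarrow> real set) \<Rightarrow> bool" where
  "poisson_process M c P \<longleftrightarrow>
     P \<in> measurable M point_space \<and>
     (\<forall>B\<in>bounded_borel. \<forall>k.
        measure M {\<omega> \<in> space M. card (P \<omega> \<inter> B) = k}
          = (c * measure lborel B) ^ k / fact k * exp (- (c * measure lborel B))) \<and>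
     (\<forall>(m::nat) B. (\<forall>l<m. B l \<in> bounded_borel) \<and> disjoint_family_on B {..<m} \<longrightarrow>
        prob_space.indep_vars M (\<lambda>_. count_space UNIV) (\<lambda>l \<omega>. card (P \<omega> \<inter> B l)) {..<m})"

definition iid_poisson_processes :: "'a measure \<Rightarrow> real \<Rightarrow> (int \<Rightarrow> 'a \<Rightarrow> real set) \<Rightarrow> bool" where
  "iid_poisson_processes M c P \<longleftrightarrow>
     prob_space.indep_vars M (\<lambda>_. point_space) P UNIV \<and> (\<forall>i. poisson_process M c (P i))"


section \<open>Aggregates\<close>

text \<open>A path that never leaves \<open>A\<close> leaves the aggregate unchanged; for finite \<open>A\<close> this
  has probability zero.\<close>

definition settle :: "(nat \<Rightarrow> site) \<Rightarrow> site set \<Rightarrow> site set" where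
  "settle p A = (if \<exists>t. p t \<notin> A then insert (p (LEAST t. p t \<notin> A)) A else A)"

definition aggregate :: "(int \<Rightarrow> nat \<Rightarrow> nat \<Rightarrow> site) \<Rightarrow> (int \<times> nat) list \<Rightarrow> site set" where
  "aggregate s ps = fold (\<lambda>(i, j). settle (s i j)) ps {}"

definition usual_order :: "nat \<Rightarrow> int list" where
  "usual_order M = 0 # concat (map (\<lambda>m. [int m, - int m]) [1..<Suc M])"

definition level_by_level :: "(int \<Rightarrow> nat) \<Rightarrow> nat \<Rightarrow> (int \<times> nat) list" where
  "level_by_level c M =
     concat (map (\<lambda>i. map (\<lambda>j. (i, j)) [1..<Suc (c i)]) (usual_order M))"

text \<open>\<open>arrivals C t\<close> is the list of the times \<open>T\<^sub>1 < T\<^sub>2 < \<dots>\<close> in \<open>C\<close> that are at most \<open>t\<close>.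
  In \<open>by_arrival\<close> each particle \<open>(i, j)\<close> is tagged with its time, and \<open>sort_key\<close> puts all the
  tagged particles in increasing order of time (being stable, it would break ties, which
  a.s. do not occur, by the usual order).\<close>

definition arrivals :: "real set \<Rightarrow> real \<Rightarrow> real list" where
  "arrivals C t = sorted_list_of_set (C \<inter> {..t})"

definition timed_particles :: "real set \<Rightarrow> real \<Rightarrow> int \<Rightarrow> (real \<times> int \<times> nat) list" where
  "timed_particles C t i =
     map (\<lambda>j. (arrivals C t ! (j - 1), i, j)) [1..<Suc (length (arrivals C t))]"

definition by_arrival :: "(int \<Rightarrow> real set) \<Rightarrow> real \<Rightarrow> nat \<Rightarrow> (int \<times> nat) list" where
  "by_arrival P t M =
     map snd (sort_key fst (concat (map (\<lambda>i. timed_particles (P i) t i) (usual_order M))))"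

definition A_inf ::
  "(int \<Rightarrow> nat \<Rightarrow> 'a \<Rightarrow> nat \<Rightarrow> site) \<Rightarrow> nat \<Rightarrow> 'a \<Rightarrow> site set" where
  "A_inf S n \<omega> = (\<Union>M. aggregate (\<lambda>i j. S i j \<omega>) (level_by_level (\<lambda>_. n) M))"

definition A_star_inf ::
  "(int \<Rightarrow> nat \<Rightarrow> 'a \<Rightarrow> nat \<Rightarrow> site) \<Rightarrow> (int \<Rightarrow> 'a \<Rightarrow> nat) \<Rightarrow> 'a \<Rightarrow> site set" where
  "A_star_inf S N \<omega> = (\<Union>M. aggregate (\<lambda>i j. S i j \<omega>) (level_by_level (\<lambda>i. N i \<omega>) M))"

definition A_dag_inf ::
  "(int \<Rightarrow> nat \<Rightarrow> 'a \<Rightarrow> nat \<Rightarrow> site) \<Rightarrow> (int \<Rightarrow> 'a \<Rightarrow> real set) \<Rightarrow> nat \<Rightarrow> 'a \<Rightarrow> site set" where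
  "A_dag_inf S P n \<omega> =
     (\<Union>M. aggregate (\<lambda>i j. S i j \<omega>) (by_arrival (\<lambda>i. P i \<omega>) (real n) M))"


section \<open>Mixing under vertical translations\<close>

definition config_space :: "site set measure" where
  "config_space = sigma UNIV (range (\<lambda>z. {C. z \<in> C}))"

definition translate :: "int \<Rightarrow> site set \<Rightarrow> site set" where
  "translate k C = (\<lambda>z. z + (0, k)) ` C"

text \<open>Measurability is included so that \<open>X\<close> has a distribution and the probabilities below
  are those of genuine events.\<close>

definition vertically_mixing :: "'a measure \<Rightarrow> ('a \<Rightarrow> site set) \<Rightarrow> bool" where
  "vertically_mixing M X \<longleftrightarrow>
     X \<in> measurable M config_space \<and>
     (\<forall>\<A>\<in>sets config_space. \<forall>\<B>\<in>sets config_space.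
        ((\<lambda>k. measure M {\<omega> \<in> space M. X \<omega> \<in> \<A> \<and> X \<omega> \<in> translate k ` \<B>})
           \<longlongrightarrow> measure M {\<omega> \<in> space M. X \<omega> \<in> \<A>} * measure M {\<omega> \<in> space M. X \<omega> \<in> \<B>})
          (filtercomap abs at_top))"

end

theory Submission
  imports Defs "HOL-Library.Sublist"
begin

text \<open>Settling is monotone in the aggregate, and the law of the aggregate of finitely many particles
  depends only on the set of particles sent: if two consecutive particles leave the current
  aggregate at the same site, exchanging their trajectories after that time preserves the law of
  the walks and reverses their order.

  Let \<open>p F\<close> be the probability that the infinite aggregate contains the finite set \<open>F\<close>, and \<open>q F I\<close>
  the same for the aggregate of the levels in a finite set \<open>I\<close>. Then \<open>q F I\<close> increases to \<open>p F\<close>, so that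
  \<open>p\<close> inherits translation invariance from \<open>q\<close>. For disjoint \<open>I\<close> and \<open>J\<close> send first the
  particles of \<open>I\<close>, then those of \<open>J\<close>, then all others. By monotonicity the result contains the two
  independent aggregates of \<open>I\<close> and of \<open>J\<close>, whence
  \<open>q F I * q G J \<le> p (F \<union> G) \<le> q F I * q G J + (p F - q F I) + (p G - q G J)\<close>.
  Taking for \<open>J\<close> a translate of a large box \<open>I\<close> gives mixing for the events \<open>F \<subseteq> A\<close>, which form a
  generating class stable under intersection. Random numbers and random orders of the
  particles are handled by conditioning on the list of particles.\<close>

section \<open>Settling particles\<close>

text \<open>Relational form of the \<open>LEAST\<close> in \<open>settle\<close>. No
  \<open>t\<close> satisfies it exactly when the path stays in \<open>A\<close> forever, so the
  default branch of \<open>settle\<close> fits in without a special value.\<close>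

definition first_exit :: "(nat \<Rightarrow> site) \<Rightarrow> site set \<Rightarrow> nat \<Rightarrow> bool" where
  "first_exit p A t \<longleftrightarrow> p t \<notin> A \<and> (\<forall>u<t. p u \<in> A)"

lemma first_exit_unique: "first_exit p A s \<Longrightarrow> first_exit p A t \<Longrightarrow> s = t"
  unfolding first_exit_def by (meson linorder_neqE_nat)

lemma first_exit_cong:
  "(\<And>u. u \<le> t \<Longrightarrow> p u = q u) \<Longrightarrow> first_exit p A t \<longleftrightarrow> first_exit q A t"
  unfolding first_exit_def by auto

lemma settle_first_exit: "first_exit p A t \<Longrightarrow> settle p A = insert (p t) A"
proof -
  assume t: "first_exit p A t"
  then have "(LEAST t. p t \<notin> A) = t"
    unfolding first_exit_def by (intro Least_equality) (auto simp: not_less[symmetric])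
  then show ?thesis
    using t unfolding settle_def first_exit_def by auto
qed

lemma settle_stay: "(\<And>t. p t \<in> A) \<Longrightarrow> settle p A = A"
  unfolding settle_def by simp

lemma settle_cases:
  obtains (stay) "\<And>t. p t \<in> A" | (exit) t where "first_exit p A t"
proof (cases "\<forall>t. p t \<in> A")
  case True
  then show ?thesis using stay by blast
next
  case False
  then have "first_exit p A (LEAST t. p t \<notin> A)"
    unfolding first_exit_def using LeastI_ex[of "\<lambda>t. p t \<notin> A"] not_less_Least by blast
  then show ?thesis by (rule exit)
qed

lemma mem_settle_iff: "z \<in> settle p A \<longleftrightarrow> z \<in> A \<or> (\<exists>t. p t = z \<and> first_exit p A t)"
proof (cases rule: settle_cases[of p A])
  case stay
  then show ?thesis by (simp add: settle_stay first_exit_def)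
next
  case (exit t)
  then have "(\<exists>s. p s = z \<and> first_exit p A s) \<longleftrightarrow> p t = z"
    using first_exit_unique by blast
  with exit show ?thesis by (auto simp: settle_first_exit)
qed

lemma settle_superset: "A \<subseteq> settle p A"
  by (auto simp: mem_settle_iff)

text \<open>A site at which the path first leaves \<open>A\<close> either lies in \<open>B\<close>
  already or is also its first exit from \<open>B\<close>, since all earlier sites lie in
  \<open>A\<close> and hence in \<open>B\<close>.\<close>

lemma settle_mono: "A \<subseteq> B \<Longrightarrow> settle p A \<subseteq> settle p B"
  unfolding mem_settle_iff subset_iff first_exit_def by blast

text \<open>The clock may be restarted at \<open>t\<close>, since the path cannot settle before.
  This lets the second of two colliding particles be resumed at the common site.\<close>

lemma settle_drop:
  assumes "\<And>u. u < t \<Longrightarrow> p u \<in> A"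
  shows "settle p A = settle (\<lambda>v. p (t + v)) A"
proof -
  have "(\<exists>s. p s = z \<and> first_exit p A s) \<longleftrightarrow> (\<exists>v. p (t + v) = z \<and> first_exit (\<lambda>v. p (t + v)) A v)"
    (is "?L \<longleftrightarrow> ?R") for z
  proof
    assume ?L
    then obtain s where s: "p s = z" "first_exit p A s" by blast
    then have "t \<le> s" using assms unfolding first_exit_def by (meson not_le_imp_less)
    then obtain v where "s = t + v" using le_Suc_ex by blast
    then show ?R using s unfolding first_exit_def by auto
  next
    assume ?R
    then obtain v where v: "p (t + v) = z" "first_exit (\<lambda>v. p (t + v)) A v" by blast
    have "p u \<in> A" if "u < t + v" for u
    proof (cases "u < t")
      case False
      then have "u = t + (u - t)" "u - t < v" using that by auto
      with v(2) show ?thesis unfolding first_exit_def by metis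
    qed (use assms in auto)
    with v have "first_exit p A (t + v)" unfolding first_exit_def by auto
    with v show ?L by blast
  qed
  then show ?thesis by (auto simp: mem_settle_iff)
qed

text \<open>Particles that would settle at different sites do not feel each other: each path meets
  only sites of \<open>A\<close> before its exit, and its exit site is not the one filled by the
  other.\<close>

lemma settle_commute:
  assumes "\<nexists>s t. first_exit p A s \<and> first_exit q A t \<and> p s = q t"
  shows "settle p (settle q A) = settle q (settle p A)"
proof (cases rule: settle_cases[of p A])
  case stay
  moreover have "p t \<in> settle q A" for t using stay settle_superset by blast
  ultimately show ?thesis by (simp add: settle_stay)
next
  case (exit s)
  note s = exit
  show ?thesis
  proof (cases rule: settle_cases[of q A])
    case stay
    moreover have "q t \<in> settle p A" for t using stay settle_superset by blast
    ultimately show ?thesis by (simp add: settle_stay)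
  next
    case (exit t)
    with s assms have ne: "p s \<noteq> q t" by blast
    have "first_exit p (insert (q t) A) s" "first_exit q (insert (p s) A) t"
      using s exit ne unfolding first_exit_def by auto
    then show ?thesis
      using s exit by (auto simp: settle_first_exit)
  qed
qed

text \<open>Both orders first fill the common exit site. The particle sent second then continues
  from that site, and in both cases it follows the tail of \<open>q\<close> after time
  \<open>t\<close>.\<close>

lemma settle_exchange_tails:
  assumes p: "first_exit p A s" and q: "first_exit q A t" and "p s = q t"
    and "\<And>u. u \<le> t \<Longrightarrow> q' u = q u" and "\<And>v. p' (s + v) = q (t + v)"
    and "\<And>u. u \<le> s \<Longrightarrow> p' u = p u"
  shows "settle q (settle p A) = settle p' (settle q' A)"
proof -
  let ?B = "insert (q t) A"
  have "first_exit q' A t" using q assms(4) first_exit_cong by blast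
  then have "settle q' A = ?B" using assms(4)[of t] by (simp add: settle_first_exit)
  moreover have "settle p A = ?B" using p \<open>p s = q t\<close> by (simp add: settle_first_exit)
  moreover have "settle q ?B = settle (\<lambda>v. q (t + v)) ?B"
    using q by (intro settle_drop) (auto simp: first_exit_def)
  moreover have "settle p' ?B = settle (\<lambda>v. p' (s + v)) ?B"
    using p assms(6) by (intro settle_drop) (auto simp: first_exit_def)
  ultimately show ?thesis using assms(5) by simp
qed

text \<open>Generalises \<open>aggregate\<close> to arbitrary labels and to any initial set, as
  inductions over lists require.\<close>

definition grow :: "('p \<Rightarrow> nat \<Rightarrow> site) \<Rightarrow> 'p list \<Rightarrow> site set \<Rightarrow> site set" where
  "grow f ps A = fold (\<lambda>p. settle (f p)) ps A"

lemma grow_simps [simp]: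
  "grow f [] A = A"
  "grow f (p # ps) A = grow f ps (settle (f p) A)"
  "grow f (ps @ qs) A = grow f qs (grow f ps A)"
  by (simp_all add: grow_def)

lemma aggregate_eq_grow: "aggregate s ps = grow (\<lambda>(i, j). s i j) ps {}"
  unfolding aggregate_def grow_def by (rule arg_cong[where f = "\<lambda>g. fold g ps {}"]) auto

lemma grow_cong: "(\<And>p. p \<in> set ps \<Longrightarrow> f p = g p) \<Longrightarrow> grow f ps A = grow g ps A"
  by (induction ps arbitrary: A) auto

text \<open>An inserted particle can only enlarge the current set, and monotonicity of
  \<open>settle\<close> carries the inclusion through all later particles.\<close>

lemma grow_mono_subseq:
  assumes "subseq ps qs" "A \<subseteq> B"
  shows "grow f ps A \<subseteq> grow f qs B"
  using assms
proof (induction arbitrary: A B rule: list_emb.induct)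
  case (list_emb_Nil ys)
  have "B \<subseteq> grow f ys B"
  proof (induction ys arbitrary: B)
    case (Cons y ys)
    then show ?case using order_trans[OF settle_superset Cons] by simp
  qed simp
  with list_emb_Nil show ?case by simp
next
  case (list_emb_Cons xs ys y)
  then show ?case using order_trans[OF _ settle_superset] by simp
next
  case (list_emb_Cons2 x y xs ys)
  then show ?case using settle_mono[of A B] by simp
qed

lemma grow_translate:
  "grow (\<lambda>p t. f p t + c) ps ((\<lambda>z. z + c) ` A) = (\<lambda>z. z + c) ` grow f ps A"
proof (induction ps arbitrary: A)
  case (Cons p ps)
  have inj: "z + c \<in> (\<lambda>z. z + c) ` A \<longleftrightarrow> z \<in> A" for z :: site and A by auto
  have exit: "first_exit (\<lambda>t. f p t + c) ((\<lambda>z. z + c) ` A) t \<longleftrightarrow> first_exit (f p) A t" for t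
    by (simp add: first_exit_def inj)
  have "settle (\<lambda>t. f p t + c) ((\<lambda>z. z + c) ` A) = (\<lambda>z. z + c) ` settle (f p) A"
  proof (cases rule: settle_cases[of "f p" A])
    case stay
    then show ?thesis by (auto simp: settle_stay)
  next
    case (exit t)
    then show ?thesis using \<open>\<And>t. first_exit _ _ t \<longleftrightarrow> _\<close> by (simp add: settle_first_exit)
  qed
  then show ?case using Cons by simp
qed simp

section \<open>Exchanging the tails of two walks\<close>

text \<open>All walks are read off one family of increments indexed by particle and time, so that
  exchanging tails becomes a permutation of the index set.\<close>

definition walk :: "('p \<Rightarrow> site) \<Rightarrow> ('p \<times> nat \<Rightarrow> site) \<Rightarrow> 'p \<Rightarrow> nat \<Rightarrow> site" where
  "walk x0 x p t = x0 p + (\<Sum>u<t. x (p, u))"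

lemma walk_0 [simp]: "walk x0 x p 0 = x0 p"
  and walk_Suc: "walk x0 x p (Suc t) = walk x0 x p t + x (p, t)"
  by (simp_all add: walk_def add.assoc)

lemma walk_cong: "(\<And>u. x (p, u) = y (p, u)) \<Longrightarrow> walk x0 x p = walk x0 y p"
  by (simp add: walk_def fun_eq_iff)

text \<open>For fixed \<open>s\<close> and \<open>t\<close> this permutes the indices of i.i.d.
  increments and so preserves their law. The random collision times are handled by splitting the
  space according to their values.\<close>

definition swap_tails :: "'p \<Rightarrow> nat \<Rightarrow> 'p \<Rightarrow> nat \<Rightarrow> 'p \<times> nat \<Rightarrow> 'p \<times> nat" where
  "swap_tails a s b t = (\<lambda>(p, u).
     if p = a \<and> s \<le> u then (b, u - s + t) else if p = b \<and> t \<le> u then (a, u - t + s) else (p, u))"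

lemma swap_tails_commute: "a \<noteq> b \<Longrightarrow> swap_tails a s b t = swap_tails b t a s"
  by (auto simp: swap_tails_def)

lemma swap_tails_involution: "a \<noteq> b \<Longrightarrow> swap_tails a s b t (swap_tails a s b t i) = i"
  by (cases i) (auto simp: swap_tails_def)

context
  fixes a b :: 'p and s t :: nat and x x' :: "'p \<times> nat \<Rightarrow> site" and x0 :: "'p \<Rightarrow> site"
  assumes ab: "a \<noteq> b" and x': "x' = (\<lambda>i. x (swap_tails a s b t i))"
begin

lemma walk_swap_other: "p \<noteq> a \<Longrightarrow> p \<noteq> b \<Longrightarrow> walk x0 x' p = walk x0 x p"
  by (rule walk_cong) (simp add: x' swap_tails_def)

lemma walk_swap_before: "u \<le> s \<Longrightarrow> walk x0 x' a u = walk x0 x a u"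
  unfolding walk_def x' swap_tails_def using ab by (auto intro!: sum.cong)

text \<open>Only increments are exchanged; the hypothesis that the walks meet upgrades this to
  equality of positions.\<close>

lemma walk_swap_after:
  assumes "walk x0 x a s = walk x0 x b t"
  shows "walk x0 x' a (s + v) = walk x0 x b (t + v)"
proof (induction v)
  case 0
  then show ?case using assms by (simp add: walk_swap_before)
next
  case (Suc v)
  have "x' (a, s + v) = x (b, t + v)"
    using ab by (simp add: x' swap_tails_def add.commute)
  with Suc show ?case by (simp add: walk_Suc)
qed

end

text \<open>The event on which the order of \<open>a\<close> and \<open>b\<close> matters.\<close>

definition collision :: "('p \<Rightarrow> nat \<Rightarrow> site) \<Rightarrow> 'p \<Rightarrow> 'p \<Rightarrow> site set \<Rightarrow> nat \<times> nat \<Rightarrow> bool" where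
  "collision f a b A = (\<lambda>(s, t). first_exit (f a) A s \<and> first_exit (f b) A t \<and> f a s = f b t)"

text \<open>The second conclusion holds because both paths are unchanged up to their exit times. It
  shows that the exchange maps the event of a collision at times \<open>(s, t)\<close> into
  itself.\<close>

lemma grow_swap_tails:
  assumes "distinct (xs @ a # b # ys)"
    and x': "x' = (\<lambda>i. x (swap_tails a s b t i))"
    and coll: "collision (walk x0 x) a b (grow (walk x0 x) xs {}) (s, t)"
  shows "grow (walk x0 x') (xs @ b # a # ys) {} = grow (walk x0 x) (xs @ a # b # ys) {}"
    and "collision (walk x0 x') a b (grow (walk x0 x') xs {}) (s, t)"
proof -
  let ?f = "walk x0 x" and ?f' = "walk x0 x'"
  have ab: "a \<noteq> b" "b \<noteq> a" using assms(1) by auto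
  have x'': "x' = (\<lambda>i. x (swap_tails b t a s i))" using x' ab by (simp add: swap_tails_commute)
  have eq: "?f a s = ?f b t" using coll by (simp add: collision_def)
  have xs: "grow ?f' xs B = grow ?f xs B" for B
    using assms(1) by (intro grow_cong walk_swap_other[OF ab(1) x']) auto
  have ys: "grow ?f' ys B = grow ?f ys B" for B
    using assms(1) by (intro grow_cong walk_swap_other[OF ab(1) x']) auto
  note before = walk_swap_before[OF ab(1) x', of _ x0] walk_swap_before[OF ab(2) x'', of _ x0]
  have "settle (?f b) (settle (?f a) (grow ?f xs {})) = settle (?f' a) (settle (?f' b) (grow ?f xs {}))"
    using coll before walk_swap_after[OF ab(1) x' eq]
    by (intro settle_exchange_tails[where s = s and t = t]) (auto simp: collision_def)
  then show "grow ?f' (xs @ b # a # ys) {} = grow ?f (xs @ a # b # ys) {}"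
    by (simp add: xs ys)
  show "collision ?f' a b (grow ?f' xs {}) (s, t)"
    using coll before first_exit_cong[of s "?f' a" "?f a"] first_exit_cong[of t "?f' b" "?f b"]
    by (auto simp: collision_def xs)
qed

section \<open>The law of an aggregate does not depend on the order of the particles\<close>

lemma pred_mem_settle:
  fixes A :: "'a \<Rightarrow> site set"
  assumes p[measurable]: "\<And>t. (\<lambda>\<omega>. p \<omega> t) \<in> N \<rightarrow>\<^sub>M count_space UNIV"
    and A[measurable]: "\<And>z. Measurable.pred N (\<lambda>\<omega>. z \<in> A \<omega>)"
  shows "Measurable.pred N (\<lambda>\<omega>. z \<in> settle (p \<omega>) (A \<omega>))"
proof -
  \<comment> \<open>Both the site and the set are random; since there are only countably many sites,
    it suffices to treat each fixed site.\<close>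
  have [measurable]: "Measurable.pred N (\<lambda>\<omega>. p \<omega> t \<in> A \<omega>)" for t
    using measurable_compose_countable[of "\<lambda>z \<omega>. z \<in> A \<omega>" N "count_space UNIV" "\<lambda>\<omega>. p \<omega> t"]
    by simp
  show ?thesis unfolding mem_settle_iff first_exit_def by measurable
qed

lemma pred_mem_grow:
  fixes A :: "'a \<Rightarrow> site set"
  assumes "\<And>p t. p \<in> set ps \<Longrightarrow> (\<lambda>\<omega>. f \<omega> p t) \<in> N \<rightarrow>\<^sub>M count_space UNIV"
    and "\<And>z. Measurable.pred N (\<lambda>\<omega>. z \<in> A \<omega>)"
  shows "Measurable.pred N (\<lambda>\<omega>. z \<in> grow (f \<omega>) ps (A \<omega>))"
  using assms
proof (induction ps arbitrary: A)
  case (Cons p ps)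
  have "Measurable.pred N (\<lambda>\<omega>. z \<in> grow (f \<omega>) ps (settle (f \<omega> p) (A \<omega>)))"
    using Cons.prems by (intro Cons.IH pred_mem_settle) auto
  then show ?case by simp
qed simp

lemma pred_subset_grow:
  fixes F :: "site set"
  assumes "\<And>p t. p \<in> set ps \<Longrightarrow> (\<lambda>\<omega>. f \<omega> p t) \<in> N \<rightarrow>\<^sub>M count_space UNIV"
  shows "Measurable.pred N (\<lambda>\<omega>. F \<subseteq> grow (f \<omega>) ps {})"
proof -
  have [measurable]: "Measurable.pred N (\<lambda>\<omega>. z \<in> grow (f \<omega>) ps {})" for z
    using assms by (intro pred_mem_grow) auto
  show ?thesis unfolding subset_iff by measurable
qed

section \<open>The canonical space of independent steps\<close>

definition step_pmf :: "site pmf" where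
  "step_pmf = pmf_of_set {(1, 0), (-1, 0), (0, 1), (0, -1)}"

text \<open>A product space on which indices can be permuted freely. Probabilities for the given
  walks are transferred to it by \<open>prob_cover\<close>.\<close>

definition steps :: "('p \<times> nat \<Rightarrow> site) measure" where
  "steps = PiM UNIV (\<lambda>_. measure_pmf step_pmf)"

lemma space_steps [simp]: "space steps = UNIV"
  by (simp add: steps_def space_PiM)

lemma prob_space_steps: "prob_space steps"
  unfolding steps_def by (intro prob_space_PiM) (rule prob_space_measure_pmf)

interpretation steps: prob_space "steps :: ('p \<times> nat \<Rightarrow> site) measure"
  by (rule prob_space_steps)

lemma measurable_steps_component [measurable]: "(\<lambda>x. x i) \<in> steps \<rightarrow>\<^sub>M count_space UNIV"
proof -
  have "(\<lambda>x. x i) \<in> steps \<rightarrow>\<^sub>M measure_pmf step_pmf"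
    unfolding steps_def by (rule measurable_component_singleton) simp
  then show ?thesis by simp
qed

lemma measurable_walk:
  assumes "\<And>u. (\<lambda>\<omega>. X \<omega> (p, u)) \<in> N \<rightarrow>\<^sub>M count_space UNIV"
  shows "(\<lambda>\<omega>. walk x0 (X \<omega>) p t) \<in> N \<rightarrow>\<^sub>M count_space UNIV"
proof (induction t)
  case (Suc t)
  note Suc[measurable] assms[measurable]
  show ?case unfolding walk_Suc
    by (rule measurable_compose_countable[OF _ Suc]) measurable
qed simp

text \<open>The coordinates are i.i.d., so reading them along any injection gives the same law. This
  serves both the exchange of tails and the relabelling of particles under a shift of
  levels.\<close>

lemma distr_steps_reindex:
  assumes "inj g"
  shows "distr steps steps (\<lambda>x i. x (g i)) = steps"
  using distr_PiM_reindex[of UNIV "\<lambda>_. measure_pmf step_pmf" g UNIV] assms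
  unfolding steps_def by (simp add: restrict_UNIV prob_space_measure_pmf)

lemma emeasure_steps_reindex:
  assumes "inj g" "Measurable.pred steps P"
  shows "emeasure steps {x. P (\<lambda>i. x (g i))} = emeasure steps {x. P x}"
proof -
  have m: "(\<lambda>x i. x (g i)) \<in> steps \<rightarrow>\<^sub>M steps"
    unfolding steps_def
    by (intro measurable_PiM_single') (simp_all add: measurable_steps_component[unfolded steps_def] space_PiM)
  have "emeasure steps {x. P x} = emeasure (distr steps steps (\<lambda>x i. x (g i))) {x. P x}"
    using assms by (simp add: distr_steps_reindex)
  also have "\<dots> = emeasure steps {x. P (\<lambda>i. x (g i))}"
    using m assms(2) by (subst emeasure_distr) (auto simp: pred_def vimage_def)
  finally show ?thesis by simp
qed

text \<open>Countable additivity. The hypotheses match the exchange argument: without a collision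
  the two events coincide as sets, while on each collision piece they are only related by a
  measure-preserving map.\<close>

lemma emeasure_eq_by_pieces:
  assumes AB: "A \<in> sets N" "B \<in> sets N" and D: "\<And>i. i \<in> I \<Longrightarrow> D i \<in> sets N" "countable I"
    and disj: "disjoint_family_on D I"
    and out: "A - (\<Union>i\<in>I. D i) = B - (\<Union>i\<in>I. D i)"
    and eq: "\<And>i. i \<in> I \<Longrightarrow> emeasure N (A \<inter> D i) = emeasure N (B \<inter> D i)"
  shows "emeasure N A = emeasure N B"
proof -
  have *: "emeasure N C = emeasure N (C - (\<Union>i\<in>I. D i)) + (\<integral>\<^sup>+i. emeasure N (C \<inter> D i) \<partial>count_space I)"
    if C: "C \<in> sets N" for C
  proof -
    have U: "(\<Union>i\<in>I. D i) \<in> sets N" "(\<Union>i\<in>I. C \<inter> D i) \<in> sets N"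
      using D C by (auto intro!: sets.countable_UN')
    have "emeasure N C = emeasure N ((C - (\<Union>i\<in>I. D i)) \<union> (\<Union>i\<in>I. C \<inter> D i))"
      by (rule arg_cong[where f = "emeasure N"]) auto
    also have "\<dots> = emeasure N (C - (\<Union>i\<in>I. D i)) + emeasure N (\<Union>i\<in>I. C \<inter> D i)"
      using C U by (intro plus_emeasure[symmetric]) auto
    also have "emeasure N (\<Union>i\<in>I. C \<inter> D i) = (\<integral>\<^sup>+i. emeasure N (C \<inter> D i) \<partial>count_space I)"
      using C D disj by (intro emeasure_UN_countable) (auto simp: disjoint_family_on_def)
    finally show ?thesis .
  qed
  have "(\<integral>\<^sup>+i. emeasure N (A \<inter> D i) \<partial>count_space I) = (\<integral>\<^sup>+i. emeasure N (B \<inter> D i) \<partial>count_space I)"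
    using eq by (intro nn_integral_cong) simp
  then show ?thesis using *[OF AB(1)] *[OF AB(2)] out by simp
qed

section \<open>Covering events and the exchange of consecutive particles\<close>

definition cover :: "('p \<Rightarrow> site) \<Rightarrow> site set \<Rightarrow> 'p list \<Rightarrow> ('p \<times> nat \<Rightarrow> site) set" where
  "cover x0 F ps = {x. F \<subseteq> grow (walk x0 x) ps {}}"

lemma sets_cover [measurable]: "cover x0 F ps \<in> sets steps"
  using pred_subset_grow[of ps "\<lambda>x. walk x0 x" steps F]
  by (simp add: cover_def pred_def measurable_walk)

text \<open>The space is split by the pair of exit times in a collision of \<open>a\<close> and
  \<open>b\<close>. Off all collisions the two particles commute; on each piece
  \<open>swap_tails\<close> carries one event onto the other.\<close>

lemma emeasure_cover_swap:
  assumes dist: "distinct (xs @ a # b # ys)"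
  shows "emeasure steps (cover x0 F (xs @ a # b # ys)) = emeasure steps (cover x0 F (xs @ b # a # ys))"
proof -
  let ?A = "\<lambda>x. grow (walk x0 x) xs {}"
  define D where "D st = {x. collision (walk x0 x) a b (?A x) st}" for st
  have ab: "a \<noteq> b" using dist by auto
  have [measurable]: "Measurable.pred steps (\<lambda>x. z \<in> ?A x)" for z
    by (intro pred_mem_grow measurable_walk) measurable
  have w[measurable]: "(\<lambda>x. walk x0 x p t) \<in> steps \<rightarrow>\<^sub>M count_space UNIV" for p t
    by (intro measurable_walk) measurable
  have [measurable]: "Measurable.pred steps (\<lambda>x. walk x0 x p t \<in> ?A x)" for p t
    using measurable_compose_countable[of "\<lambda>z x. z \<in> ?A x" steps "count_space UNIV" "\<lambda>x. walk x0 x p t"]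
    by simp
  have D_sets[measurable]: "D st \<in> sets steps" for st
  proof -
    have "Measurable.pred steps (\<lambda>x. collision (walk x0 x) a b (?A x) st)"
      unfolding collision_def first_exit_def by (cases st) (simp, measurable)
    then show ?thesis by (simp add: pred_def D_def)
  qed
  show ?thesis
  proof (rule emeasure_eq_by_pieces[where D = D and I = UNIV])
    \<comment> \<open>First exit times are unique, so a configuration has at most one pair of
      collision times.\<close>
    show "disjoint_family_on D UNIV"
      by (auto simp: disjoint_family_on_def D_def collision_def dest: first_exit_unique)
    have "x \<in> cover x0 F (xs @ a # b # ys) \<longleftrightarrow> x \<in> cover x0 F (xs @ b # a # ys)"
      if "x \<notin> (\<Union>i. D i)" for x
    proof -
      have "settle (walk x0 x b) (settle (walk x0 x a) (?A x)) = settle (walk x0 x a) (settle (walk x0 x b) (?A x))"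
        using that by (intro settle_commute[symmetric]) (auto simp: D_def collision_def)
      then show ?thesis by (simp add: cover_def)
    qed
    then show "cover x0 F (xs @ a # b # ys) - (\<Union>i\<in>UNIV. D i) = cover x0 F (xs @ b # a # ys) - (\<Union>i\<in>UNIV. D i)"
      by auto
    fix st :: "nat \<times> nat"
    obtain s t where st: "st = (s, t)" by force
    let ?g = "swap_tails a s b t"
    have inv: "?g (?g i) = i" for i by (rule swap_tails_involution[OF ab])
    then have inj: "inj ?g" by (metis injI)
    have mem: "x \<in> cover x0 F (xs @ a # b # ys) \<inter> D st \<longleftrightarrow>
        (\<lambda>i. x (?g i)) \<in> cover x0 F (xs @ b # a # ys) \<inter> D st" (is "?L \<longleftrightarrow> ?R") for x
    proof
      assume ?L
      then show ?R using grow_swap_tails[OF dist refl, of x0 x s t] by (simp add: cover_def D_def st)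
    next
      assume ?R
      let ?x = "\<lambda>i. x (?g i)"
      \<comment> \<open>The converse is the forward direction for the exchanged configuration
        \<open>?x\<close>, with the roles of \<open>a\<close>, \<open>s\<close> and
        \<open>b\<close>, \<open>t\<close> interchanged; it leads back to \<open>x\<close> because
        the exchange is an involution.\<close>
      have x: "x = (\<lambda>i. ?x (swap_tails b t a s i))"
        using inv swap_tails_commute[OF ab, of s t] by simp
      have dist': "distinct (xs @ b # a # ys)" using dist by auto
      have "collision (walk x0 ?x) b a (?A ?x) (t, s)"
        using \<open>?R\<close> by (simp add: D_def st collision_def)
      from grow_swap_tails[OF dist' x this] \<open>?R\<close> show ?L
        by (simp add: cover_def D_def st collision_def)
    qed
    have P: "Measurable.pred steps (\<lambda>x. x \<in> cover x0 F (xs @ b # a # ys) \<inter> D st)"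
      by measurable
    show "emeasure steps (cover x0 F (xs @ a # b # ys) \<inter> D st) = emeasure steps (cover x0 F (xs @ b # a # ys) \<inter> D st)"
      using emeasure_steps_reindex[OF inj P] by (simp only: mem[symmetric] Collect_mem_eq)
  qed auto
qed

lemma emeasure_cover_move:
  "distinct (xs @ us @ a # ys) \<Longrightarrow>
    emeasure steps (cover x0 F (xs @ us @ a # ys)) = emeasure steps (cover x0 F (xs @ a # us @ ys))"
proof (induction us arbitrary: xs)
  case (Cons u us)
  have "emeasure steps (cover x0 F ((xs @ [u]) @ us @ a # ys)) = emeasure steps (cover x0 F ((xs @ [u]) @ a # us @ ys))"
    using Cons.prems by (intro Cons.IH) auto
  also have "\<dots> = emeasure steps (cover x0 F (xs @ a # u # us @ ys))"
    using Cons.prems emeasure_cover_swap[of xs u a "us @ ys" x0 F] by auto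
  finally show ?case by simp
qed simp

text \<open>The head of \<open>ps\<close> is moved to the front of \<open>qs\<close> by adjacent
  transpositions and then joins the common prefix \<open>xs\<close>, which is why the induction
  carries a prefix.\<close>

lemma emeasure_cover_perm_append:
  assumes "distinct (xs @ ps)" "distinct qs" "set ps = set qs"
  shows "emeasure steps (cover x0 F (xs @ ps)) = emeasure steps (cover x0 F (xs @ qs))"
  using assms
proof (induction ps arbitrary: xs qs)
  case (Cons a ps)
  then obtain us vs where qs: "qs = us @ a # vs" by (metis list.set_intros(1) split_list)
  have "set xs \<inter> set qs = {}" using Cons.prems by auto
  then have dist: "distinct (xs @ us @ a # vs)" using Cons.prems qs by auto
  have "set ps = set (us @ vs)" using Cons.prems qs by auto
  then have "emeasure steps (cover x0 F ((xs @ [a]) @ ps)) = emeasure steps (cover x0 F ((xs @ [a]) @ us @ vs))"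
    using Cons.prems qs by (intro Cons.IH) auto
  also have "\<dots> = emeasure steps (cover x0 F (xs @ us @ a # vs))"
    using emeasure_cover_move[OF dist, of x0 F] by simp
  finally show ?case by (simp add: qs)
qed simp

text \<open>For finite \<open>U\<close> the chosen enumeration does not matter, by invariance under
  reordering. For infinite \<open>U\<close> no enumeration exists and the value carries no
  meaning.\<close>

definition cover_prob :: "('p \<Rightarrow> site) \<Rightarrow> site set \<Rightarrow> 'p set \<Rightarrow> real" where
  "cover_prob x0 F U = measure steps (cover x0 F (SOME ps. distinct ps \<and> set ps = U))"

lemma cover_prob_eq:
  assumes "distinct ps"
  shows "measure steps (cover x0 F ps) = cover_prob x0 F (set ps)"
proof -
  define qs where "qs = (SOME qs. distinct qs \<and> set qs = set ps)"
  have "distinct qs \<and> set qs = set ps"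
    unfolding qs_def by (rule someI[of _ ps]) (use assms in simp)
  with assms emeasure_cover_perm_append[of "[]" ps qs x0 F] show ?thesis
    by (simp add: cover_prob_def qs_def[symmetric] measure_def)
qed

section \<open>Monotonicity, independence and translation of covering probabilities\<close>

lemma cover_prob_bounds: "0 \<le> cover_prob x0 F U" "cover_prob x0 F U \<le> 1"
  by (auto simp: cover_prob_def)

lemma cover_mono_subseq: "subseq ps qs \<Longrightarrow> cover x0 F ps \<subseteq> cover x0 F qs"
  unfolding cover_def using grow_mono_subseq by blast

text \<open>As the order is free, the particles of \<open>U\<close> can be sent first; their
  aggregate is then an intermediate stage of that of \<open>V\<close>.\<close>

lemma cover_prob_mono:
  assumes "finite V" "U \<subseteq> V"
  shows "cover_prob x0 F U \<le> cover_prob x0 F V"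
proof -
  obtain ps where ps: "distinct ps" "set ps = U"
    using assms finite_distinct_list finite_subset by metis
  obtain qs where qs: "distinct qs" "set qs = V - U"
    using assms finite_distinct_list finite_Diff by metis
  have "measure steps (cover x0 F ps) \<le> measure steps (cover x0 F (ps @ qs))"
    by (intro steps.finite_measure_mono cover_mono_subseq) auto
  then show ?thesis
    using ps qs assms cover_prob_eq[of ps x0 F] cover_prob_eq[of "ps @ qs" x0 F]
    by (simp add: Un_absorb1)
qed

text \<open>The aggregate reads only the increments of the listed particles. Covering events thus
  become functions of coordinate blocks, as independence requires.\<close>

lemma cover_restrict:
  "x \<in> cover x0 F ps \<longleftrightarrow> restrict x (set ps \<times> UNIV) \<in> cover x0 F ps"
  unfolding cover_def mem_Collect_eq
  by (intro arg_cong[where f = "\<lambda>A. F \<subseteq> A"] grow_cong walk_cong) auto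

lemma distr_steps_component: "distr steps (count_space UNIV) (\<lambda>x. x i) = measure_pmf step_pmf"
proof -
  have "distr steps (measure_pmf step_pmf) (\<lambda>x. x i) = measure_pmf step_pmf"
    unfolding steps_def by (rule distr_PiM_component) (auto intro: prob_space_measure_pmf)
  then show ?thesis by (subst (asm) distr_cong[OF refl, of _ "count_space UNIV"]) auto
qed

lemma indep_vars_steps: "steps.indep_vars (\<lambda>_. count_space UNIV) (\<lambda>i x. x i) UNIV"
proof (subst steps.indep_vars_iff_distr_eq_PiM)
  have "sets (PiM UNIV (\<lambda>_ :: 'a \<times> nat. count_space (UNIV :: site set))) = sets steps"
    unfolding steps_def by (intro sets_PiM_cong) auto
  then have "distr steps (PiM UNIV (\<lambda>_. count_space UNIV)) (\<lambda>x. \<lambda>i\<in>UNIV. x i) = distr steps (steps :: ('a \<times> nat \<Rightarrow> _) measure) (\<lambda>x. x)"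
    by (intro distr_cong) auto
  then show "distr steps (PiM UNIV (\<lambda>_. count_space UNIV)) (\<lambda>x. \<lambda>i\<in>UNIV. x i) =
      PiM UNIV (\<lambda>i :: 'a \<times> nat. distr steps (count_space UNIV) (\<lambda>x. x i))"
    by (simp add: distr_steps_component) (simp add: steps_def)
qed auto

lemma sets_cover_PiM:
  assumes "set ps \<times> UNIV \<subseteq> I"
  shows "{x \<in> space (PiM I (\<lambda>_. count_space UNIV)). x \<in> cover x0 F ps} \<in> sets (PiM I (\<lambda>_. count_space UNIV))"
proof -
  have "(\<lambda>x. walk x0 x p t) \<in> PiM I (\<lambda>_. count_space UNIV) \<rightarrow>\<^sub>M count_space UNIV" if "p \<in> set ps" for p t
    using assms that by (intro measurable_walk measurable_component_singleton) auto
  then show ?thesis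
    unfolding cover_def mem_Collect_eq by (intro pred_subset_grow[unfolded pred_def])
qed

lemma indep_cover:
  fixes ps qs :: "'p list"
  assumes "set ps \<inter> set qs = {}"
  shows "measure steps (cover x0 F ps \<inter> cover x0 G qs) = measure steps (cover x0 F ps) * measure steps (cover x0 G qs)"
proof -
  let ?I = "\<lambda>ps. set ps \<times> (UNIV :: nat set)"
  let ?P = "\<lambda>ps. PiM (?I ps) (\<lambda>_. count_space UNIV) :: ('p \<times> nat \<Rightarrow> site) measure"
  let ?C = "\<lambda>F ps. {x \<in> space (?P ps). x \<in> cover x0 F ps}"
  have "steps.indep_var (?P ps) (\<lambda>x. restrict x (?I ps)) (?P qs) (\<lambda>x. restrict x (?I qs))"
    by (rule steps.indep_var_restrict[OF indep_vars_steps]) (use assms in auto)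
  from steps.indep_varD[OF this sets_cover_PiM[of ps "?I ps" x0 F] sets_cover_PiM[of qs "?I qs" x0 G]]
  have "measure steps ((\<lambda>x. (restrict x (?I ps), restrict x (?I qs))) -` (?C F ps \<times> ?C G qs)) =
      measure steps ((\<lambda>x. restrict x (?I ps)) -` ?C F ps) * measure steps ((\<lambda>x. restrict x (?I qs)) -` ?C G qs)"
    by simp
  moreover have C: "(\<lambda>x. restrict x (?I ps)) -` ?C F ps = cover x0 F ps" for F and ps :: "'p list"
    by (auto simp: cover_restrict[symmetric] space_PiM)
  moreover have "(\<lambda>x. (restrict x (?I ps), restrict x (?I qs))) -` (?C F ps \<times> ?C G qs) =
      (\<lambda>x. restrict x (?I ps)) -` ?C F ps \<inter> (\<lambda>x. restrict x (?I qs)) -` ?C G qs"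
    by blast
  ultimately show ?thesis by simp
qed

text \<open>Send the particles of \<open>U\<close> first, then those of \<open>V\<close>, then the remaining ones: by monotonicity
  the first two groups cover at least what each would cover alone.\<close>

lemma cover_prob_Un_bounds:
  assumes "finite W" "U \<union> V \<subseteq> W" "U \<inter> V = {}"
  shows "cover_prob x0 F U * cover_prob x0 G V \<le> cover_prob x0 (F \<union> G) W" (is ?lower)
    and "cover_prob x0 (F \<union> G) W \<le> cover_prob x0 F U * cover_prob x0 G V
      + (cover_prob x0 F W - cover_prob x0 F U) + (cover_prob x0 G W - cover_prob x0 G V)" (is ?upper)
proof -
  have "finite U" "finite V" using assms finite_subset by auto
  then obtain us vs ws where us: "distinct us" "set us = U" and vs: "distinct vs" "set vs = V"
    and ws: "distinct ws" "set ws = W - (U \<union> V)"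
    using finite_distinct_list assms(1) by (metis finite_Diff)
  let ?w = "us @ vs @ ws"
  have w: "distinct ?w" "set ?w = W" using us vs ws assms by auto
  have sub: "cover x0 F us \<subseteq> cover x0 F ?w" "cover x0 G vs \<subseteq> cover x0 G ?w"
    by (intro cover_mono_subseq list_emb_append2 prefix_imp_subseq; simp)+
  have Un: "cover x0 (F \<union> G) ?w = cover x0 F ?w \<inter> cover x0 G ?w" by (auto simp: cover_def)
  have prod: "measure steps (cover x0 F us \<inter> cover x0 G vs) = measure steps (cover x0 F us) * measure steps (cover x0 G vs)"
    using us vs assms by (intro indep_cover) simp
  have "measure steps (cover x0 F us \<inter> cover x0 G vs) \<le> measure steps (cover x0 (F \<union> G) ?w)"
    unfolding Un using sub by (intro steps.finite_measure_mono) auto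
  then show ?lower
    using prod us vs w cover_prob_eq by metis
  \<comment> \<open>If all particles together cover both sets, then either each group already covers
    its own set, or one of the two sets is covered only with the help of other particles. The
    inclusions \<open>sub\<close> turn the last two events into differences of
    probabilities.\<close>
  have "measure steps (cover x0 (F \<union> G) ?w) \<le> measure steps ((cover x0 F us \<inter> cover x0 G vs)
      \<union> ((cover x0 F ?w - cover x0 F us) \<union> (cover x0 G ?w - cover x0 G vs)))"
    unfolding Un by (intro steps.finite_measure_mono) auto
  also have "\<dots> \<le> measure steps (cover x0 F us \<inter> cover x0 G vs)
      + (measure steps (cover x0 F ?w - cover x0 F us) + measure steps (cover x0 G ?w - cover x0 G vs))"
    by (intro order_trans[OF measure_Un_le] add_left_mono measure_Un_le) auto
  also have "\<dots> = measure steps (cover x0 F us) * measure steps (cover x0 G vs)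
      + (measure steps (cover x0 F ?w) - measure steps (cover x0 F us))
      + (measure steps (cover x0 G ?w) - measure steps (cover x0 G vs))"
    using sub by (simp add: prod steps.finite_measure_Diff)
  finally show ?upper
    using us vs w cover_prob_eq by metis
qed

text \<open>The walk labelled \<open>g p\<close> is the walk of \<open>p\<close> driven by the
  reindexed increments and moved by \<open>c\<close>. The aggregate is therefore translated, while
  the increments keep their law.\<close>

lemma cover_prob_reindex:
  assumes "inj g" and x0: "\<And>p. x0 (g p) = x0 p + c" and "finite U"
  shows "cover_prob x0 ((\<lambda>z. z + c) ` F) (g ` U) = cover_prob x0 F U"
proof -
  obtain ps where ps: "distinct ps" "set ps = U"
    using \<open>finite U\<close> finite_distinct_list by metis
  let ?g = "\<lambda>(p, u). (g p, u)"
  have inj: "inj ?g" using \<open>inj g\<close> by (auto simp: inj_on_def)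
  have grow_map: "grow f (map g ps) A = grow (\<lambda>p. f (g p)) ps A" for f A and ps :: "'a list"
    by (induction ps arbitrary: A) auto
  have walk: "(\<lambda>p. walk x0 x (g p)) = (\<lambda>p t. walk x0 (\<lambda>i. x (?g i)) p t + c)" for x
    by (simp add: walk_def x0 fun_eq_iff algebra_simps)
  have "grow (walk x0 x) (map g ps) {} = (\<lambda>z. z + c) ` grow (walk x0 (\<lambda>i. x (?g i))) ps {}" for x
    using grow_translate[of "walk x0 (\<lambda>i. x (?g i))" c ps "{}"] by (simp add: grow_map walk)
  then have "cover x0 ((\<lambda>z. z + c) ` F) (map g ps) = {x. (\<lambda>i. x (?g i)) \<in> cover x0 F ps}"
    unfolding cover_def by (auto simp: inj_image_subset_iff)
  then have "measure steps (cover x0 ((\<lambda>z. z + c) ` F) (map g ps)) = measure steps (cover x0 F ps)"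
    using emeasure_steps_reindex[OF inj, of "\<lambda>x. x \<in> cover x0 F ps"]
    by (simp add: measure_def pred_def)
  then show ?thesis
    using ps \<open>inj g\<close> cover_prob_eq[of ps x0 F] cover_prob_eq[of "map g ps" x0 "(\<lambda>z. z + c) ` F"]
    by (simp add: distinct_map inj_on_subset)
qed

section \<open>The increments of independent walks\<close>

text \<open>Combines independence between the walks with independence of the steps of each walk: the
  probability of a finite intersection factors first over \<open>p\<close>, then over
  \<open>t\<close>.\<close>

lemma (in prob_space) indep_vars_nested:
  assumes X: "indep_vars (\<lambda>_. K) X P"
    and Y: "\<And>t. t \<in> T \<Longrightarrow> Y t \<in> K \<rightarrow>\<^sub>M L"
    and XY: "\<And>p. p \<in> P \<Longrightarrow> indep_vars (\<lambda>_. L) (\<lambda>t \<omega>. Y t (X p \<omega>)) T"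
  shows "indep_vars (\<lambda>_. L) (\<lambda>(p, t) \<omega>. Y t (X p \<omega>)) (P \<times> T)"
proof -
  have X_rv[measurable]: "random_variable K (X p)" if "p \<in> P" for p
    using X that by (simp add: indep_vars_def2)
  let ?Z = "\<lambda>i \<omega>. Y (snd i) (X (fst i) \<omega>)"
  have rv: "random_variable L (?Z i)" if "i \<in> P \<times> T" for i
    using that by (intro measurable_compose[OF X_rv Y]) auto
  have "prob (\<Inter>i\<in>J. A i) = (\<Prod>i\<in>J. prob (A i))"
    if J: "J \<subseteq> P \<times> T" "J \<noteq> {}" "finite J"
      and A: "A \<in> Pi J (\<lambda>i. {?Z i -` B \<inter> space M | B. B \<in> sets L})" for J A
  proof -
    from A obtain B where B: "\<And>i. i \<in> J \<Longrightarrow> A i = ?Z i -` B i \<inter> space M \<and> B i \<in> sets L"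
      unfolding Pi_iff mem_Collect_eq by metis
    \<comment> \<open>Padding with \<open>space L\<close> replaces \<open>J\<close> by the rectangle
      \<open>Q \<times> R\<close>; the added events are the whole space and contribute factors
      1.\<close>
    define C where "C i = (if i \<in> J then B i else space L)" for i
    let ?A = "\<lambda>p t. (\<lambda>\<omega>. Y t (X p \<omega>)) -` C (p, t) \<inter> space M"
    define Q where "Q = fst ` J"
    define R where "R = snd ` J"
    have QR: "finite Q" "finite R" "Q \<noteq> {}" "R \<noteq> {}" "Q \<subseteq> P" "R \<subseteq> T" "J \<subseteq> Q \<times> R"
      using J by (force simp: Q_def R_def)+
    have C: "C i \<in> sets L" for i using B by (simp add: C_def)
    have full: "?A p t = space M" if "(p, t) \<in> Q \<times> R - J" for p t
      using that QR rv[of "(p, t)"] by (auto simp: C_def measurable_def)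
    have A_eq: "?A (fst i) (snd i) = A i" if "i \<in> J" for i
      using B[OF that] that by (simp add: C_def)
    have inner: "(\<Inter>t\<in>R. ?A p t) = X p -` {y \<in> space K. \<forall>t\<in>R. Y t y \<in> C (p, t)} \<inter> space M"
      if "p \<in> Q" for p
      using QR that measurable_space[OF X_rv] by auto
    have K_sets: "{y \<in> space K. \<forall>t\<in>R. Y t y \<in> C (p, t)} \<in> sets K" for p
    proof -
      have "{y \<in> space K. Y t y \<in> C (p, t)} \<in> sets K" if "t \<in> R" for t
        using measurable_sets[OF Y C] QR that by (simp add: vimage_def Int_def conj_commute subset_iff)
      then show ?thesis using QR by (intro sets.sets_Collect_finite_All') auto
    qed
    have "(\<Inter>i\<in>J. A i) = (\<Inter>p\<in>Q. \<Inter>t\<in>R. ?A p t)"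
    proof (intro set_eqI iffI)
      fix \<omega> assume \<omega>: "\<omega> \<in> (\<Inter>i\<in>J. A i)"
      with J have "\<omega> \<in> space M" using B by blast
      have "\<omega> \<in> ?A p t" if "p \<in> Q" "t \<in> R" for p t
      proof (cases "(p, t) \<in> J")
        case True
        with \<omega> A_eq[OF True] show ?thesis by auto
      next
        case False
        with that have "(p, t) \<in> Q \<times> R - J" by simp
        from full[OF this] \<open>\<omega> \<in> space M\<close> show ?thesis by simp
      qed
      then show "\<omega> \<in> (\<Inter>p\<in>Q. \<Inter>t\<in>R. ?A p t)" by (intro INT_I)
    next
      fix \<omega> assume \<omega>: "\<omega> \<in> (\<Inter>p\<in>Q. \<Inter>t\<in>R. ?A p t)"
      have "\<omega> \<in> A i" if "i \<in> J" for i
      proof -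
        have "fst i \<in> Q" "snd i \<in> R" using that by (auto simp: Q_def R_def)
        then have "\<omega> \<in> ?A (fst i) (snd i)"
          by (rule INT_D[OF INT_D[OF \<omega>]])
        then show ?thesis by (simp only: A_eq[OF that])
      qed
      then show "\<omega> \<in> (\<Inter>i\<in>J. A i)" by (intro INT_I)
    qed
    also have "prob \<dots> = (\<Prod>p\<in>Q. prob (\<Inter>t\<in>R. ?A p t))"
    proof (rule indep_setsD[OF _ QR(5,3,1)])
      show "indep_sets (\<lambda>p. {X p -` A \<inter> space M | A. A \<in> sets K}) P"
        using X by (simp add: indep_vars_def2)
      show "\<forall>p\<in>Q. (\<Inter>t\<in>R. ?A p t) \<in> {X p -` A \<inter> space M | A. A \<in> sets K}"
        by (intro ballI CollectI exI conjI, erule inner, rule K_sets)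
    qed
    also have "\<dots> = (\<Prod>p\<in>Q. \<Prod>t\<in>R. prob (?A p t))"
    proof (intro prod.cong refl indep_setsD[OF _ QR(6,4,2)])
      fix p assume "p \<in> Q"
      then show "indep_sets (\<lambda>t. {(\<lambda>\<omega>. Y t (X p \<omega>)) -` A \<inter> space M | A. A \<in> sets L}) T"
        using XY QR(5) by (auto simp: indep_vars_def2)
      show "\<forall>t\<in>R. ?A p t \<in> {(\<lambda>\<omega>. Y t (X p \<omega>)) -` A \<inter> space M | A. A \<in> sets L}"
        by (intro ballI CollectI exI conjI, rule refl, rule C)
    qed
    also have "\<dots> = (\<Prod>i\<in>Q \<times> R. prob (?A (fst i) (snd i)))"
      by (simp add: prod.cartesian_product split_def)
    also have "\<dots> = (\<Prod>i\<in>J. prob (?A (fst i) (snd i)))"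
      using QR full by (intro prod.mono_neutral_right) (auto simp: prob_space)
    also have "\<dots> = (\<Prod>i\<in>J. prob (A i))"
      using A_eq by (intro prod.cong) auto
    finally show ?thesis .
  qed
  then have "indep_sets (\<lambda>i. {?Z i -` A \<inter> space M | A. A \<in> sets L}) (P \<times> T)"
    using rv unfolding indep_sets_def by (auto intro: measurable_sets)
  then have "indep_vars (\<lambda>_. L) ?Z (P \<times> T)"
    using rv unfolding indep_vars_def2 by auto
  then show ?thesis by (simp add: split_def)
qed

definition start :: "int \<times> nat \<Rightarrow> site" where
  "start = (\<lambda>(i, j). (0, i))"

lemma measurable_path_space_component: "(\<lambda>y. y t) \<in> path_space \<rightarrow>\<^sub>M count_space UNIV"
  unfolding path_space_def by (rule measurable_component_singleton) simp

lemma measurable_path_space_increment: "(\<lambda>y. y (Suc t) - y t) \<in> path_space \<rightarrow>\<^sub>M count_space UNIV"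
proof -
  note measurable_path_space_component[measurable]
  show ?thesis
    by (rule measurable_compose_countable[OF _ measurable_path_space_component[of t]]) measurable
qed

section \<open>Transfer from the given walks to the canonical space\<close>

locale walks = prob_space M for M :: "'a measure" +
  fixes S :: "int \<Rightarrow> nat \<Rightarrow> 'a \<Rightarrow> nat \<Rightarrow> site"
  assumes indep_walks: "independent_walks M S"
begin

abbreviation walk_at :: "'a \<Rightarrow> int \<times> nat \<Rightarrow> nat \<Rightarrow> site" where
  "walk_at \<omega> p \<equiv> S (fst p) (snd p) \<omega>"

lemma aggregate_eq: "aggregate (\<lambda>i j. S i j \<omega>) ps = grow (walk_at \<omega>) ps {}"
  by (simp add: aggregate_eq_grow split_def)

definition increment :: "(int \<times> nat) \<times> nat \<Rightarrow> 'a \<Rightarrow> site" where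
  "increment = (\<lambda>(p, t) \<omega>. walk_at \<omega> p (Suc t) - walk_at \<omega> p t)"

text \<open>Restricted to genuine particles because nothing is assumed about
  \<open>S i 0\<close>.\<close>

abbreviation increments :: "'a \<Rightarrow> (int \<times> nat) \<times> nat \<Rightarrow> site" where
  "increments \<omega> \<equiv> (\<lambda>i\<in>particle_indices \<times> UNIV. increment i \<omega>)"

lemma walk_at_measurable:
  assumes "p \<in> particle_indices"
  shows "(\<lambda>\<omega>. walk_at \<omega> p) \<in> M \<rightarrow>\<^sub>M path_space"
  using indep_walks assms by (auto simp: independent_walks_def indep_vars_def2 split_def)

lemma simple_random_walk_at:
  "p \<in> particle_indices \<Longrightarrow> simple_random_walk M (start p) (\<lambda>\<omega>. walk_at \<omega> p)"
  using indep_walks by (auto simp: independent_walks_def start_def)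

lemma indep_vars_increment: "indep_vars (\<lambda>_. count_space UNIV) increment (particle_indices \<times> UNIV)"
  unfolding increment_def
proof (rule indep_vars_nested[of path_space "\<lambda>p \<omega>. walk_at \<omega> p" particle_indices UNIV "\<lambda>t y. y (Suc t) - y t"])
  show "indep_vars (\<lambda>_. path_space) (\<lambda>p \<omega>. walk_at \<omega> p) particle_indices"
    using indep_walks by (simp add: independent_walks_def split_def)
qed (use simple_random_walk_at in \<open>auto simp: simple_random_walk_def measurable_path_space_increment\<close>)

lemma increment_measurable:
  "i \<in> particle_indices \<times> UNIV \<Longrightarrow> increment i \<in> M \<rightarrow>\<^sub>M count_space UNIV"
  using indep_vars_increment unfolding indep_vars_def2 by blast

lemma distr_increment:
  "i \<in> particle_indices \<times> UNIV \<Longrightarrow> distr M (count_space UNIV) (increment i) = measure_pmf step_pmf"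
  using simple_random_walk_at[of "fst i"]
  by (auto simp: simple_random_walk_def increment_def split_def step_pmf_def)

lemma walk_increments:
  assumes "p \<in> particle_indices" "\<omega> \<in> space M"
  shows "walk start (increments \<omega>) p t = walk_at \<omega> p t"
proof (induction t)
  case 0
  show ?case using simple_random_walk_at[OF assms(1)] assms(2) by (simp add: simple_random_walk_def)
next
  case (Suc t)
  then show ?case using assms by (simp add: walk_Suc increment_def)
qed

text \<open>On both sides the coordinates are independent with the step law, so both joint laws are
  the same product measure.\<close>

lemma distr_increments:
  defines "I \<equiv> particle_indices \<times> (UNIV :: nat set)"
  shows "distr M (PiM I (\<lambda>_. count_space UNIV)) increments =
    distr steps (PiM I (\<lambda>_. count_space UNIV)) (\<lambda>x. restrict x I)"
proof -
  have I: "I \<noteq> {}" by (auto simp: I_def particle_indices_def)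
  have "distr M (PiM I (\<lambda>_. count_space UNIV)) increments = PiM I (\<lambda>i. distr M (count_space UNIV) (increment i))"
    using indep_vars_increment indep_vars_iff_distr_eq_PiM'[OF I, of increment "\<lambda>_. count_space UNIV"]
    by (simp add: I_def increment_measurable)
  also have "\<dots> = PiM I (\<lambda>i. distr steps (count_space UNIV) (\<lambda>x. x i))"
    by (intro PiM_cong refl) (simp add: distr_increment distr_steps_component I_def)
  also have "\<dots> = distr steps (PiM I (\<lambda>_. count_space UNIV)) (\<lambda>x. restrict x I)"
    using steps.indep_vars_subset[OF indep_vars_steps subset_UNIV, of I]
      steps.indep_vars_iff_distr_eq_PiM'[OF I, of "\<lambda>i x. x i" "\<lambda>_. count_space UNIV"]
    by (simp add: restrict_def)
  finally show ?thesis .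
qed

text \<open>The walks are recovered from their increments and starting points, so the event is a
  function of the increments, whose law is the canonical one.\<close>

lemma prob_cover:
  assumes "set ps \<subseteq> particle_indices"
  shows "prob {\<omega> \<in> space M. F \<subseteq> aggregate (\<lambda>i j. S i j \<omega>) ps} = measure steps (cover start F ps)"
proof -
  let ?I = "particle_indices \<times> (UNIV :: nat set)"
  let ?P = "PiM ?I (\<lambda>_. count_space (UNIV :: site set))"
  let ?C = "{x \<in> space ?P. x \<in> cover start F ps}"
  have C: "?C \<in> sets ?P" using assms by (intro sets_cover_PiM) auto
  have mem: "increments \<omega> \<in> ?C \<longleftrightarrow> F \<subseteq> aggregate (\<lambda>i j. S i j \<omega>) ps" if "\<omega> \<in> space M" for \<omega>
  proof -
    have "grow (walk start (increments \<omega>)) ps {} = grow (walk_at \<omega>) ps {}"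
      using assms that by (intro grow_cong ext walk_increments) auto
    then show ?thesis by (auto simp: space_PiM cover_def aggregate_eq)
  qed
  have "x \<in> cover start F ps \<longleftrightarrow> restrict x ?I \<in> cover start F ps" for x
    using assms unfolding cover_def mem_Collect_eq
    by (intro arg_cong[where f = "\<lambda>A. F \<subseteq> A"] grow_cong walk_cong) auto
  then have steps_C: "(\<lambda>x. restrict x ?I) -` ?C \<inter> space steps = cover start F ps"
    by (auto simp: space_PiM)
  have "increments \<in> M \<rightarrow>\<^sub>M ?P"
    by (intro measurable_restrict increment_measurable)
  then have "measure (distr M ?P increments) ?C = prob {\<omega> \<in> space M. F \<subseteq> aggregate (\<lambda>i j. S i j \<omega>) ps}"
    using C mem by (subst measure_distr) (auto intro!: arg_cong[where f = prob])
  moreover have "measure (distr steps ?P (\<lambda>x. restrict x ?I)) ?C = measure steps (cover start F ps)"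
    using C steps_C by (subst measure_distr) (auto intro!: measurable_restrict)
  ultimately show ?thesis by (simp add: distr_increments)
qed

end

section \<open>Mixing on a generating class\<close>

text \<open>The sets \<open>B\<close> with the stated limit form a Dynkin system: complements are
  subtracted from \<open>space \<nu>\<close>, which lies in \<open>E\<close>, and disjoint unions
  follow by Tannery's theorem. The event \<open>D k\<close> may vary with \<open>k\<close>, so that
  either of the two mixing events can be the one extended.\<close>

lemma (in prob_space) tendsto_prob_sigma_sets:
  fixes Z :: "'k \<Rightarrow> 'a \<Rightarrow> 'b" and \<nu> :: "'b measure"
  assumes nontriv: "Fl \<noteq> bot"
    and Z: "\<And>k. Z k \<in> M \<rightarrow>\<^sub>M \<nu>" "\<And>k. distr M \<nu> (Z k) = \<nu>"
    and D: "\<And>k. D k \<in> events"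
    and E: "Int_stable E" "E \<subseteq> Pow (space \<nu>)" "space \<nu> \<in> E" "sets \<nu> = sigma_sets (space \<nu>) E"
    and lim: "\<And>B. B \<in> E \<Longrightarrow> ((\<lambda>k. prob (D k \<inter> (Z k -` B \<inter> space M))) \<longlongrightarrow> d * measure \<nu> B) Fl"
    and "B \<in> sets \<nu>"
  shows "((\<lambda>k. prob (D k \<inter> (Z k -` B \<inter> space M))) \<longlongrightarrow> d * measure \<nu> B) Fl"
proof -
  have \<nu>: "measure \<nu> B = prob (Z k -` B \<inter> space M)" if "B \<in> sets \<nu>" for B k
    using that Z(1) Z(2)[of k] by (metis measure_distr)
  interpret \<nu>: prob_space \<nu>
    using prob_space_distr[OF Z(1)] Z(2) by metis
  note [measurable] = Z(1) D
  have "B \<in> sigma_sets (space \<nu>) E" using \<open>B \<in> sets \<nu>\<close> E by simp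
  with E(1,2) show ?thesis
  proof (induction rule: sigma_sets_induct_disjoint)
    case (basic B)
    then show ?case by (rule lim)
  next
    case empty
    show ?case by simp
  next
    case (compl B)
    then have B[measurable]: "B \<in> sets \<nu>" using E by simp
    have "D k \<inter> (Z k -` space \<nu> \<inter> space M) - (D k \<inter> (Z k -` B \<inter> space M))
        = D k \<inter> (Z k -` (space \<nu> - B) \<inter> space M)" for k
      by auto
    then have "prob (D k \<inter> (Z k -` (space \<nu> - B) \<inter> space M)) =
        prob (D k \<inter> (Z k -` space \<nu> \<inter> space M)) - prob (D k \<inter> (Z k -` B \<inter> space M))" for k
      using sets.sets_into_space[OF B]
      by (metis (no_types, lifting) finite_measure_Diff Int_mono subset_refl vimage_mono
          sets.Int measurable_sets[OF Z(1)] D B sets.top)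
    moreover have "d * measure \<nu> (space \<nu> - B) = d * measure \<nu> (space \<nu>) - d * measure \<nu> B"
      using B by (simp add: \<nu>.finite_measure_compl right_diff_distrib)
    ultimately show ?case
      using tendsto_diff[OF lim[OF E(3)] compl.IH] by simp
  next
    case (union A)
    then have A[measurable]: "A i \<in> sets \<nu>" for i using E(4) by auto
    let ?a = "\<lambda>i k. prob (D k \<inter> (Z k -` A i \<inter> space M))"
    have disj: "disjoint_family A" by fact
    have "(\<lambda>i. ?a i k) sums prob (\<Union>i. D k \<inter> (Z k -` A i \<inter> space M))" for k
      using disj by (intro finite_measure_UNION) (auto simp: disjoint_family_on_def)
    then have sum: "prob (D k \<inter> (Z k -` (\<Union>i. A i) \<inter> space M)) = (\<Sum>i. ?a i k)" for k
      by (simp add: sums_iff vimage_UN Int_UN_distrib Int_UN_distrib2)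
    have \<nu>_sums: "(\<lambda>i. measure \<nu> (A i)) sums measure \<nu> (\<Union>i. A i)"
      using disj by (intro \<nu>.finite_measure_UNION) auto
    \<comment> \<open>All \<open>Z k\<close> have law \<open>\<nu>\<close>, which gives a summable
      bound that is uniform in \<open>k\<close>.\<close>
    have bound: "norm (?a i k) \<le> measure \<nu> (A i)" for i k
      using \<nu>[OF A, of i k] by (auto intro!: finite_measure_mono)
    have "((\<lambda>k. \<Sum>i. ?a i k) \<longlongrightarrow> (\<Sum>i. d * measure \<nu> (A i))) Fl"
      using tannerys_theorem[of ?a "\<lambda>i. d * measure \<nu> (A i)" Fl "\<lambda>i. measure \<nu> (A i)"]
        union.IH bound \<nu>_sums nontriv by (simp add: sums_iff split_def)
    then show ?case
      using \<nu>_sums by (simp add: sum sums_iff suminf_mult)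
  qed
qed

text \<open>Increasing cylinder events: monotonicity of aggregates controls their probabilities, and
  they generate \<open>config_space\<close> while being stable under intersection.\<close>

definition covering_sets :: "site set set set" where
  "covering_sets = {{C. F \<subseteq> C} | F. finite F}"

lemma space_config_space [simp]: "space config_space = UNIV"
  by (simp add: config_space_def space_measure_of_conv)

lemma covering_set_in_config_space: "finite F \<Longrightarrow> {C. F \<subseteq> C} \<in> sets config_space"
proof (induction rule: finite_induct)
  case empty
  then show ?case using sets.top[of config_space] by simp
next
  case (insert z F)
  have "{C. z \<in> C} \<in> sets config_space"
    by (auto simp: config_space_def sets_measure_of_conv intro: sigma_sets.Basic)
  moreover have "{C. insert z F \<subseteq> C} = {C. z \<in> C} \<inter> {C. F \<subseteq> C}" by auto
  ultimately show ?case using insert by auto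
qed

lemma sets_config_space: "sets config_space = sigma_sets UNIV covering_sets"
proof -
  have "{C. z \<in> C} = {C. {z} \<subseteq> C}" for z :: site by auto
  then have "{C. z \<in> C} \<in> covering_sets" for z :: site unfolding covering_sets_def by blast
  then have "sigma_sets UNIV (range (\<lambda>z. {C. z \<in> C})) = sigma_sets UNIV covering_sets"
    using covering_set_in_config_space
    by (intro sigma_sets_eqI) (auto simp: covering_sets_def config_space_def sets_measure_of_conv)
  then show ?thesis by (simp add: config_space_def sets_measure_of_conv)
qed

lemma Int_stable_covering_sets: "Int_stable covering_sets"
proof (rule Int_stableI)
  fix A B assume "A \<in> covering_sets" "B \<in> covering_sets"
  then obtain F G where "A = {C. F \<subseteq> C}" "B = {C. G \<subseteq> C}" "finite F" "finite G"
    by (auto simp: covering_sets_def)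
  then have "A \<inter> B = {C. F \<union> G \<subseteq> C}" "finite (F \<union> G)" by auto
  then show "A \<inter> B \<in> covering_sets" unfolding covering_sets_def by blast
qed

lemma UNIV_covering_sets: "UNIV \<in> covering_sets"
proof -
  have "UNIV = {C :: site set. {} \<subseteq> C}" by auto
  then show ?thesis unfolding covering_sets_def by blast
qed

lemma measurable_config_spaceI:
  assumes "\<And>z. Measurable.pred N (\<lambda>\<omega>. z \<in> X \<omega>)"
  shows "X \<in> N \<rightarrow>\<^sub>M config_space"
  unfolding config_space_def using assms
  by (intro measurable_measure_of) (auto simp: pred_def vimage_def Int_def conj_commute)

lemma mem_translate: "z \<in> translate k C \<longleftrightarrow> z - (0, k) \<in> C"
  unfolding translate_def by (auto simp: image_iff) (metis diff_add_cancel)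

lemma translate_translate_uminus: "translate k (translate (- k) C) = C"
  by (auto simp: mem_translate set_eq_iff)

lemma mem_translate_image: "C \<in> translate k ` B \<longleftrightarrow> translate (- k) C \<in> B"
  using translate_translate_uminus[of k] translate_translate_uminus[of "- k"]
  by (metis image_iff)

lemma subset_translate: "G \<subseteq> translate (- k) C \<longleftrightarrow> translate k G \<subseteq> C"
proof -
  have "z - (0, - k) = z + (0, k)" for z :: site by (cases z) simp
  then show ?thesis
    unfolding translate_def[of k] image_subset_iff by (auto simp: mem_translate)
qed

lemma measurable_translate: "translate k \<in> config_space \<rightarrow>\<^sub>M config_space"
proof (rule measurable_config_spaceI)
  fix z
  have "{C. z - (0, k) \<in> C} \<in> sets config_space"
    using covering_set_in_config_space[of "{z - (0, k)}"] by simp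
  then show "Measurable.pred config_space (\<lambda>C. z \<in> translate k C)"
    by (simp add: pred_def mem_translate)
qed

lemma filtercomap_abs_at_top_neq_bot: "filtercomap (abs :: int \<Rightarrow> int) at_top \<noteq> bot"
proof
  assume "filtercomap (abs :: int \<Rightarrow> int) at_top = bot"
  then have "eventually (\<lambda>_. False) (filtercomap (abs :: int \<Rightarrow> int) at_top)" by simp
  then obtain K :: int where "\<And>x. \<bar>x :: int\<bar> \<ge> K \<Longrightarrow> False"
    unfolding eventually_filtercomap_at_top_linorder by auto
  from this[OF abs_ge_self] show False .
qed

text \<open>The translate is moved from the event to the configuration, giving \<open>?Y k\<close>.
  The limit then passes from covering events to arbitrary ones, one event at a time.\<close>

lemma (in prob_space) vertically_mixingI:
  assumes X: "X \<in> M \<rightarrow>\<^sub>M config_space"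
    and inv: "\<And>F k. finite F \<Longrightarrow> prob {\<omega> \<in> space M. translate k F \<subseteq> X \<omega>} = prob {\<omega> \<in> space M. F \<subseteq> X \<omega>}"
    and mix: "\<And>F G. finite F \<Longrightarrow> finite G \<Longrightarrow>
      ((\<lambda>k. prob {\<omega> \<in> space M. F \<union> translate k G \<subseteq> X \<omega>}) \<longlongrightarrow>
        prob {\<omega> \<in> space M. F \<subseteq> X \<omega>} * prob {\<omega> \<in> space M. G \<subseteq> X \<omega>}) (filtercomap abs at_top)"
  shows "vertically_mixing M X"
proof -
  let ?\<nu> = "distr M config_space X"
  let ?Y = "\<lambda>k \<omega>. translate (- k) (X \<omega>)"
  have Y: "?Y k \<in> M \<rightarrow>\<^sub>M config_space" for k
    by (rule measurable_compose[OF X measurable_translate])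
  have emb: "prob {\<omega> \<in> space M. F \<subseteq> X \<omega>} = measure ?\<nu> {C. F \<subseteq> C}" if "finite F" for F
    using covering_set_in_config_space[OF that] X
    by (subst measure_distr) (auto intro!: arg_cong[where f = prob])
  \<comment> \<open>Invariance on an intersection-stable generator determines the law, so every
    \<open>?Y k\<close> is distributed like \<open>X\<close>.\<close>
  have distr_Y: "distr M config_space (?Y k) = ?\<nu>" for k
  proof (rule measure_eqI_generator_eq[where E = covering_sets and \<Omega> = UNIV and A = "\<lambda>_. UNIV"])
    fix B assume "B \<in> covering_sets"
    then obtain F where F: "B = {C. F \<subseteq> C}" "finite F" by (auto simp: covering_sets_def)
    have "emeasure (distr M config_space (?Y k)) B = prob {\<omega> \<in> space M. translate k F \<subseteq> X \<omega>}"
      using covering_set_in_config_space[OF F(2)] Y[of k] F(1)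
      by (subst emeasure_distr) (auto simp: subset_translate emeasure_eq_measure intro!: arg_cong[where f = prob])
    moreover have "emeasure ?\<nu> B = prob {\<omega> \<in> space M. F \<subseteq> X \<omega>}"
      using covering_set_in_config_space[OF F(2)] X F(1)
      by (subst emeasure_distr) (auto simp: emeasure_eq_measure intro!: arg_cong[where f = prob])
    ultimately show "emeasure (distr M config_space (?Y k)) B = emeasure ?\<nu> B"
      using inv[OF F(2)] by simp
  next
    show "emeasure (distr M config_space (?Y k)) UNIV \<noteq> \<infinity>"
      using prob_space.emeasure_space_1[OF prob_space_distr[OF Y]] by simp
  qed (simp_all add: Int_stable_covering_sets UNIV_covering_sets sets_config_space)
  have covering_sets_events: "X -` A \<inter> space M \<in> events" if "A \<in> covering_sets" for A
    using that X by (intro measurable_sets[OF X]) (auto simp: sets_config_space)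
  have lim1: "((\<lambda>k. prob ((X -` A \<inter> space M) \<inter> (?Y k -` B \<inter> space M))) \<longlongrightarrow> measure ?\<nu> A * measure ?\<nu> B)
      (filtercomap abs at_top)"
    if A: "A \<in> covering_sets" and B: "B \<in> sets config_space" for A B
  proof (rule tendsto_prob_sigma_sets[where E = covering_sets])
    fix B assume "B \<in> covering_sets"
    with A obtain F G where FG: "A = {C. F \<subseteq> C}" "finite F" "B = {C. G \<subseteq> C}" "finite G"
      by (auto simp: covering_sets_def)
    have "(X -` A \<inter> space M) \<inter> (?Y k -` B \<inter> space M) = {\<omega> \<in> space M. F \<union> translate k G \<subseteq> X \<omega>}" for k
      by (auto simp: FG subset_translate)
    then show "((\<lambda>k. prob ((X -` A \<inter> space M) \<inter> (?Y k -` B \<inter> space M))) \<longlongrightarrow> measure ?\<nu> A * measure ?\<nu> B)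
      (filtercomap abs at_top)"
      using mix[OF FG(2,4)] emb FG by simp
  next
    show "distr M ?\<nu> (?Y k) = ?\<nu>" for k
      using distr_Y by (simp cong: distr_cong)
  qed (use Y A B X covering_sets_events filtercomap_abs_at_top_neq_bot Int_stable_covering_sets UNIV_covering_sets in
      \<open>simp_all add: sets_config_space\<close>)
  \<comment> \<open>Second extension, with the roles exchanged: now the event of \<open>?Y k\<close>
    is the given one, which depends on \<open>k\<close>, and the event of \<open>X\<close> ranges
    over the generated sets.\<close>
  have lim2: "((\<lambda>k. prob ((?Y k -` B \<inter> space M) \<inter> (X -` A \<inter> space M))) \<longlongrightarrow> measure ?\<nu> B * measure ?\<nu> A)
      (filtercomap abs at_top)"
    if A: "A \<in> sets config_space" and B: "B \<in> sets config_space" for A B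
  proof (rule tendsto_prob_sigma_sets[where E = covering_sets])
    fix A assume "A \<in> covering_sets"
    from lim1[OF this B] show "((\<lambda>k. prob ((?Y k -` B \<inter> space M) \<inter> (X -` A \<inter> space M))) \<longlongrightarrow> measure ?\<nu> B * measure ?\<nu> A)
      (filtercomap abs at_top)"
      by (simp add: Int_commute mult.commute)
  next
    show "distr M ?\<nu> X = ?\<nu>" for k :: int
      by (simp cong: distr_cong)
    show "?Y k -` B \<inter> space M \<in> events" for k
      using Y B by (rule measurable_sets)
  qed (use X A filtercomap_abs_at_top_neq_bot Int_stable_covering_sets UNIV_covering_sets in
      \<open>simp_all add: sets_config_space\<close>)
  have "measure ?\<nu> A = prob {\<omega> \<in> space M. X \<omega> \<in> A}" if "A \<in> sets config_space" for A
    using that X by (subst measure_distr) (auto intro!: arg_cong[where f = prob])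
  moreover have "(?Y k -` B \<inter> space M) \<inter> (X -` A \<inter> space M) =
      {\<omega> \<in> space M. X \<omega> \<in> A \<and> X \<omega> \<in> translate k ` B}" for A B k
    by (auto simp: mem_translate_image)
  ultimately show ?thesis
    using X lim2 unfolding vertically_mixing_def by (simp add: mult.commute)
qed

section \<open>Aggregates with random numbers of particles\<close>

text \<open>Unordered content of \<open>level_by_level\<close>, for arbitrary sets of levels instead
  of symmetric boxes.\<close>

definition particles :: "(int \<Rightarrow> nat) \<Rightarrow> int set \<Rightarrow> (int \<times> nat) set" where
  "particles c I = (SIGMA i:I. {1..c i})"

lemma finite_particles: "finite I \<Longrightarrow> finite (particles c I)"
  by (simp add: particles_def)

lemma particles_mono: "I \<subseteq> J \<Longrightarrow> particles c I \<subseteq> particles c J"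
  by (auto simp: particles_def)

lemma particles_restrict: "particles (restrict c I) I = particles c I"
  by (auto simp: particles_def)

lemma particles_shift: "particles c ((\<lambda>i. i + k) ` I) = (\<lambda>(i, j). (i + k, j)) ` particles (\<lambda>i. c (i + k)) I"
  by (force simp: particles_def)

text \<open>Common frame of the three models: \<open>c\<close> counts the particles of each level
  and \<open>L m\<close> lists those of the box of size \<open>m\<close> in sending order. The order
  may be random and mix levels; \<open>subseq_L\<close> says that a larger box only inserts
  particles, and \<open>indep_L\<close> gives independence of list and walks in the form suited to
  conditioning on the list.\<close>

locale random_aggregate = walks +
  fixes c :: "int \<Rightarrow> 'a \<Rightarrow> nat" and L :: "nat \<Rightarrow> 'a \<Rightarrow> (int \<times> nat) list"
  assumes indep_counts: "indep_vars (\<lambda>_. count_space UNIV) c UNIV"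
    and distr_counts: "distr M (count_space UNIV) (c i) = distr M (count_space UNIV) (c 0)"
    and L_measurable: "L m \<in> M \<rightarrow>\<^sub>M count_space UNIV"
    and distinct_L: "\<omega> \<in> space M \<Longrightarrow> distinct (L m \<omega>)"
    and set_L: "\<omega> \<in> space M \<Longrightarrow> set (L m \<omega>) = particles (\<lambda>i. c i \<omega>) {- int m..int m}"
    and subseq_L: "\<omega> \<in> space M \<Longrightarrow> subseq (L m \<omega>) (L (Suc m) \<omega>)"
    and indep_L: "set l \<subseteq> particle_indices \<Longrightarrow>
      prob {\<omega> \<in> space M. L m \<omega> = l \<and> F \<subseteq> aggregate (\<lambda>i j. S i j \<omega>) l} =
      prob {\<omega> \<in> space M. L m \<omega> = l} * prob {\<omega> \<in> space M. F \<subseteq> aggregate (\<lambda>i j. S i j \<omega>) l}"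
begin

abbreviation limit_aggregate :: "'a \<Rightarrow> site set" where
  "limit_aggregate \<omega> \<equiv> (\<Union>m. aggregate (\<lambda>i j. S i j \<omega>) (L m \<omega>))"

abbreviation count :: "'a \<Rightarrow> int \<Rightarrow> nat" where
  "count \<omega> \<equiv> \<lambda>i. c i \<omega>"

text \<open>The quantity \<open>q F I\<close> of the introduction. As it averages an order-free
  probability over the counts, it makes sense for every finite \<open>I\<close>, in particular for
  translated boxes, to which no list \<open>L m\<close> corresponds.\<close>

definition box_prob :: "site set \<Rightarrow> int set \<Rightarrow> real" where
  "box_prob F I = expectation (\<lambda>\<omega>. cover_prob start F (particles (count \<omega>) I))"

text \<open>A finite product of countable discrete spaces is discrete.\<close>

lemma measurable_count_functional:
  fixes h :: "(int \<Rightarrow> nat) \<Rightarrow> real"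
  assumes "finite I"
  shows "h \<in> PiM I (\<lambda>_. count_space UNIV) \<rightarrow>\<^sub>M borel"
  using assms by (simp add: count_space_PiM_finite)

lemma counts_measurable: "c i \<in> M \<rightarrow>\<^sub>M count_space UNIV"
  using indep_counts by (simp add: indep_vars_def2)

lemma restrict_counts_measurable:
  "(\<lambda>\<omega>. restrict (count \<omega>) I) \<in> M \<rightarrow>\<^sub>M PiM I (\<lambda>_. count_space UNIV)"
  by (intro measurable_restrict counts_measurable)

lemma cover_prob_counts_measurable:
  assumes "finite I"
  shows "(\<lambda>\<omega>. cover_prob start F (particles (count \<omega>) I)) \<in> borel_measurable M"
  using measurable_compose[OF restrict_counts_measurable measurable_count_functional[OF assms],
      of "\<lambda>d. cover_prob start F (particles d I)"]
  by (simp add: particles_restrict)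

lemma integrable_cover_prob_counts:
  "finite I \<Longrightarrow> integrable M (\<lambda>\<omega>. cover_prob start F (particles (count \<omega>) I))"
  by (rule integrable_const_bound[where B = 1])
    (simp_all add: cover_prob_bounds cover_prob_counts_measurable)

lemma box_prob_mono: "finite J \<Longrightarrow> I \<subseteq> J \<Longrightarrow> box_prob F I \<le> box_prob F J"
  unfolding box_prob_def
  by (intro integral_mono integrable_cover_prob_counts cover_prob_mono finite_particles particles_mono)
    (auto intro: finite_subset)

lemma expectation_cover_prob_mult:
  assumes "finite I" "finite J" "I \<inter> J = {}"
  shows "expectation (\<lambda>\<omega>. cover_prob start F (particles (count \<omega>) I) * cover_prob start G (particles (count \<omega>) J))
    = box_prob F I * box_prob G J"
proof -
  have "indep_var (PiM I (\<lambda>_. count_space UNIV)) (\<lambda>\<omega>. restrict (count \<omega>) I)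
      (PiM J (\<lambda>_. count_space UNIV)) (\<lambda>\<omega>. restrict (count \<omega>) J)"
    by (rule indep_var_restrict[OF indep_counts]) (use assms in auto)
  from indep_var_compose[OF this measurable_count_functional[OF assms(1), of "\<lambda>d. cover_prob start F (particles d I)"]
      measurable_count_functional[OF assms(2), of "\<lambda>d. cover_prob start G (particles d J)"]]
  have "indep_var borel (\<lambda>\<omega>. cover_prob start F (particles (count \<omega>) I))
      borel (\<lambda>\<omega>. cover_prob start G (particles (count \<omega>) J))"
    by (simp add: comp_def particles_restrict)
  then show ?thesis
    unfolding box_prob_def using assms
    by (intro indep_var_lebesgue_integral integrable_cover_prob_counts)
qed

lemma distr_shifted_counts:
  assumes "finite I" "I \<noteq> {}"
  shows "distr M (PiM I (\<lambda>_. count_space UNIV)) (\<lambda>\<omega>. \<lambda>i\<in>I. c (i + k) \<omega>) =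
    PiM I (\<lambda>_. distr M (count_space UNIV) (c 0))"
proof -
  \<comment> \<open>The singleton blocks \<open>{i + k}\<close> reindex the independent family
    \<open>c\<close> by \<open>i\<close>.\<close>
  have "indep_vars (\<lambda>i. PiM {i + k} (\<lambda>_. count_space UNIV)) (\<lambda>i \<omega>. restrict (count \<omega>) {i + k}) I"
    by (rule indep_vars_restrict[OF indep_counts]) (auto simp: disjoint_family_on_def)
  then have "indep_vars (\<lambda>_. count_space UNIV) (\<lambda>i \<omega>. restrict (count \<omega>) {i + k} (i + k)) I"
    by (rule indep_vars_compose2) (rule measurable_component_singleton, simp)
  then have "indep_vars (\<lambda>_. count_space UNIV) (\<lambda>i. c (i + k)) I" by simp
  then have "distr M (PiM I (\<lambda>_. count_space UNIV)) (\<lambda>\<omega>. \<lambda>i\<in>I. c (i + k) \<omega>) =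
      PiM I (\<lambda>i. distr M (count_space UNIV) (c (i + k)))"
    using indep_vars_iff_distr_eq_PiM'[OF assms(2), of "\<lambda>i. c (i + k)" "\<lambda>_. count_space UNIV"]
    by (simp add: counts_measurable)
  then show ?thesis by (simp add: distr_counts[of "_ + k"])
qed

text \<open>Translation acts on the walks, where \<open>cover_prob_reindex\<close> absorbs it, and
  on the counts, whose joint law over \<open>I\<close> is the same for the shifts \<open>k\<close>
  and 0. Empty \<open>I\<close> is separate since the product form of independence asks for a
  nonempty index set.\<close>

lemma box_prob_translate:
  assumes "finite I"
  shows "box_prob (translate k F) ((\<lambda>i. i + k) ` I) = box_prob F I"
proof (cases "I = {}")
  case True
  then show ?thesis
    using cover_prob_eq[of "[]" start F] cover_prob_eq[of "[]" start "translate k F"]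
    by (simp add: box_prob_def particles_def cover_def translate_def)
next
  case False
  let ?h = "\<lambda>d. cover_prob start F (particles d I)"
  have shift: "expectation (\<lambda>\<omega>. ?h (\<lambda>i. c (i + k) \<omega>)) =
      integral\<^sup>L (PiM I (\<lambda>_. distr M (count_space UNIV) (c 0))) ?h" for k
  proof -
    have "integral\<^sup>L (distr M (PiM I (\<lambda>_. count_space UNIV)) (\<lambda>\<omega>. \<lambda>i\<in>I. c (i + k) \<omega>)) ?h
        = expectation (\<lambda>\<omega>. ?h (\<lambda>i\<in>I. c (i + k) \<omega>))"
      using assms
      by (intro integral_distr measurable_restrict counts_measurable measurable_count_functional)
    then show ?thesis
      using distr_shifted_counts[OF assms False] by (simp add: particles_restrict)
  qed
  have "cover_prob start (translate k F) (particles (count \<omega>) ((\<lambda>i. i + k) ` I)) = ?h (\<lambda>i. c (i + k) \<omega>)" for \<omega>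
    unfolding particles_shift translate_def using assms
    by (intro cover_prob_reindex) (auto simp: inj_on_def start_def finite_particles)
  then have "box_prob (translate k F) ((\<lambda>i. i + k) ` I) = expectation (\<lambda>\<omega>. ?h (\<lambda>i. c (i + k) \<omega>))"
    by (simp add: box_prob_def)
  then show ?thesis
    using shift[of k] shift[of 0] by (simp add: box_prob_def)
qed

text \<open>The bounds for fixed counts are integrated; the product term factors because disjoint
  sets of levels have independent counts.\<close>

lemma box_prob_Un_bounds:
  assumes "finite K" "I \<union> J \<subseteq> K" "I \<inter> J = {}"
  shows "box_prob F I * box_prob G J \<le> box_prob (F \<union> G) K"
    and "box_prob (F \<union> G) K \<le> box_prob F I * box_prob G J
      + (box_prob F K - box_prob F I) + (box_prob G K - box_prob G J)"
proof -
  have fin: "finite I" "finite J" using assms finite_subset by auto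
  let ?w = "\<lambda>F I \<omega>. cover_prob start F (particles (count \<omega>) I)"
  have int: "integrable M (\<lambda>\<omega>. ?w F I \<omega> * ?w G J \<omega>)"
    using fin by (intro integrable_const_bound[where B = 1] borel_measurable_times cover_prob_counts_measurable)
      (auto simp: cover_prob_bounds abs_mult mult_le_one)
  note integrable = int integrable_cover_prob_counts[OF fin(1)] integrable_cover_prob_counts[OF fin(2)]
    integrable_cover_prob_counts[OF assms(1)]
  have sub: "particles (count \<omega>) I \<union> particles (count \<omega>) J \<subseteq> particles (count \<omega>) K"
    and disj: "particles (count \<omega>) I \<inter> particles (count \<omega>) J = {}" for \<omega>
    using assms by (auto simp: particles_def)
  note bounds = cover_prob_Un_bounds[OF finite_particles[OF assms(1)] sub disj]
  have "expectation (\<lambda>\<omega>. ?w F I \<omega> * ?w G J \<omega>) \<le> box_prob (F \<union> G) K"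
    unfolding box_prob_def using integrable bounds(1) by (intro integral_mono)
  then show "box_prob F I * box_prob G J \<le> box_prob (F \<union> G) K"
    using fin assms by (simp add: expectation_cover_prob_mult)
  have "box_prob (F \<union> G) K \<le> expectation (\<lambda>\<omega>. ?w F I \<omega> * ?w G J \<omega>
      + (?w F K \<omega> - ?w F I \<omega>) + (?w G K \<omega> - ?w G J \<omega>))"
    unfolding box_prob_def using integrable bounds(2)
    by (intro integral_mono Bochner_Integration.integrable_add Bochner_Integration.integrable_diff)
  also have "\<dots> = expectation (\<lambda>\<omega>. ?w F I \<omega> * ?w G J \<omega>)
      + (box_prob F K - box_prob F I) + (box_prob G K - box_prob G J)"
    unfolding box_prob_def using integrable by simp
  finally show "box_prob (F \<union> G) K \<le> box_prob F I * box_prob G J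
      + (box_prob F K - box_prob F I) + (box_prob G K - box_prob G J)"
    using fin assms by (simp add: expectation_cover_prob_mult)
qed

section \<open>Conditioning on the list of particles\<close>

lemma pred_subset_aggregate:
  "set l \<subseteq> particle_indices \<Longrightarrow> Measurable.pred M (\<lambda>\<omega>. F \<subseteq> aggregate (\<lambda>i j. S i j \<omega>) l)"
  unfolding aggregate_eq
  by (intro pred_subset_grow measurable_compose[OF walk_at_measurable measurable_path_space_component]) auto

lemma set_L_subset: "\<omega> \<in> space M \<Longrightarrow> set (L m \<omega>) \<subseteq> particle_indices"
  by (auto simp: set_L particles_def particle_indices_def)

lemma pred_subset_aggregate_L: "Measurable.pred M (\<lambda>\<omega>. F \<subseteq> aggregate (\<lambda>i j. S i j \<omega>) (L m \<omega>))"
proof -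
  let ?G = "{l. set l \<subseteq> particle_indices}"
  have "(\<lambda>\<omega>. F \<subseteq> aggregate (\<lambda>i j. S i j \<omega>) (L m \<omega>)) \<in> M \<rightarrow>\<^sub>M count_space UNIV"
  \<comment> \<open>There are countably many lists; only lists of genuine particles are allowed, as
    measurability is known for their walks alone.\<close>
  proof (rule measurable_compose_countable'[where I = ?G])
    show "L m \<in> M \<rightarrow>\<^sub>M count_space ?G"
      using L_measurable[of m] set_L_subset by (auto simp: measurable_count_space_eq_countable)
  qed (use pred_subset_aggregate in auto)
  then show ?thesis .
qed

text \<open>Condition on the list: given its value, only its set of particles matters.\<close>

lemma prob_subset_aggregate_L:
  "prob {\<omega> \<in> space M. F \<subseteq> aggregate (\<lambda>i j. S i j \<omega>) (L m \<omega>)} = box_prob F {- int m..int m}"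
proof -
  let ?G = "{l :: (int \<times> nat) list. set l \<subseteq> particle_indices \<and> distinct l}"
  let ?E = "\<lambda>l. {\<omega> \<in> space M. L m \<omega> = l}"
  let ?E' = "\<lambda>l. {\<omega> \<in> space M. L m \<omega> = l \<and> F \<subseteq> aggregate (\<lambda>i j. S i j \<omega>) l}"
  let ?w = "\<lambda>l. cover_prob start F (set l)"
  have E[measurable]: "?E l \<in> events" for l
    using measurable_sets[OF L_measurable[of m], of "{l}"] by (simp add: vimage_def Int_def conj_commute)
  have E': "?E' l \<in> events" if "l \<in> ?G" for l
  proof -
    have "{\<omega> \<in> space M. F \<subseteq> aggregate (\<lambda>i j. S i j \<omega>) l} \<in> events"
      using pred_subset_aggregate[of l F] that by (simp add: pred_def)
    moreover have "?E' l = ?E l \<inter> {\<omega> \<in> space M. F \<subseteq> aggregate (\<lambda>i j. S i j \<omega>) l}" by auto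
    ultimately show ?thesis using E by simp
  qed
  have L_in: "L m \<omega> \<in> ?G" if "\<omega> \<in> space M" for \<omega>
    using that set_L_subset distinct_L by simp
  have "emeasure M {\<omega> \<in> space M. F \<subseteq> aggregate (\<lambda>i j. S i j \<omega>) (L m \<omega>)} = emeasure M (\<Union>l\<in>?G. ?E' l)"
    using L_in by (intro arg_cong[where f = "emeasure M"]) auto
  also have "\<dots> = (\<integral>\<^sup>+l. emeasure M (?E' l) \<partial>count_space ?G)"
    using E' by (intro emeasure_UN_countable) (auto simp: disjoint_family_on_def)
  also have "\<dots> = (\<integral>\<^sup>+l. ennreal (?w l) * emeasure M (?E l) \<partial>count_space ?G)"
  proof (rule nn_integral_cong)
    fix l assume "l \<in> space (count_space ?G)"
    then have "prob (?E' l) = ?w l * prob (?E l)"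
      using indep_L[of l m F] prob_cover[of l F] cover_prob_eq[of l start F] by simp
    then show "emeasure M (?E' l) = ennreal (?w l) * emeasure M (?E l)"
      by (simp add: emeasure_eq_measure ennreal_mult cover_prob_bounds)
  qed
  also have "\<dots> = (\<integral>\<^sup>+l. (\<integral>\<^sup>+\<omega>. ennreal (?w l) * indicator (?E l) \<omega> \<partial>M) \<partial>count_space ?G)"
    by (intro nn_integral_cong) (simp add: nn_integral_cmult)
  \<comment> \<open>After exchanging sum and integral, only the term \<open>l = L m \<omega>\<close>
    survives for each \<open>\<omega>\<close>.\<close>
  also have "\<dots> = (\<integral>\<^sup>+\<omega>. (\<integral>\<^sup>+l. ennreal (?w l) * indicator (?E l) \<omega> \<partial>count_space ?G) \<partial>M)"
    by (intro nn_integral_count_space_nn_integral[symmetric]) auto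
  also have "\<dots> = (\<integral>\<^sup>+\<omega>. ennreal (?w (L m \<omega>)) \<partial>M)"
  proof (rule nn_integral_cong)
    fix \<omega> assume \<omega>: "\<omega> \<in> space M"
    have "(\<integral>\<^sup>+l. ennreal (?w l) * indicator (?E l) \<omega> \<partial>count_space ?G) =
        (\<integral>\<^sup>+l. ennreal (?w (L m \<omega>)) * indicator {L m \<omega>} l \<partial>count_space ?G)"
      using \<omega> by (intro nn_integral_cong) (auto split: split_indicator)
    also have "\<dots> = ennreal (?w (L m \<omega>))"
      using L_in[OF \<omega>] by (simp add: nn_integral_cmult)
    finally show "(\<integral>\<^sup>+l. ennreal (?w l) * indicator (?E l) \<omega> \<partial>count_space ?G) = ennreal (?w (L m \<omega>))" .
  qed
  also have "\<dots> = (\<integral>\<^sup>+\<omega>. ennreal (cover_prob start F (particles (count \<omega>) {- int m..int m})) \<partial>M)"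
    by (intro nn_integral_cong) (simp add: set_L)
  also have "\<dots> = ennreal (box_prob F {- int m..int m})"
    unfolding box_prob_def
    by (intro nn_integral_eq_integral integrable_cover_prob_counts) (simp_all add: cover_prob_bounds)
  finally show ?thesis
    by (simp add: emeasure_eq_measure box_prob_def cover_prob_bounds)
qed

section \<open>Passage to the infinite aggregate\<close>

lemma aggregate_L_incseq: "\<omega> \<in> space M \<Longrightarrow> incseq (\<lambda>m. aggregate (\<lambda>i j. S i j \<omega>) (L m \<omega>))"
  unfolding aggregate_eq by (intro incseq_SucI grow_mono_subseq subseq_L) auto

lemma subset_limit_aggregate_iff:
  assumes "finite F" "\<omega> \<in> space M"
  shows "F \<subseteq> limit_aggregate \<omega> \<longleftrightarrow> (\<exists>m. F \<subseteq> aggregate (\<lambda>i j. S i j \<omega>) (L m \<omega>))"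
proof
  assume "F \<subseteq> limit_aggregate \<omega>"
  with assms(1) show "\<exists>m. F \<subseteq> aggregate (\<lambda>i j. S i j \<omega>) (L m \<omega>)"
  proof (induction rule: finite_induct)
    case (insert z F)
    then obtain m m' where m: "z \<in> aggregate (\<lambda>i j. S i j \<omega>) (L m \<omega>)"
        "F \<subseteq> aggregate (\<lambda>i j. S i j \<omega>) (L m' \<omega>)" by auto
    have "aggregate (\<lambda>i j. S i j \<omega>) (L k \<omega>) \<subseteq> aggregate (\<lambda>i j. S i j \<omega>) (L (max m m') \<omega>)"
      if "k \<le> max m m'" for k
      using aggregate_L_incseq[OF assms(2)] that by (auto simp: incseq_def)
    from this[of m] this[of m'] m have "insert z F \<subseteq> aggregate (\<lambda>i j. S i j \<omega>) (L (max m m') \<omega>)"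
      by auto
    then show ?case by blast
  qed simp
qed auto

abbreviation limit_prob :: "site set \<Rightarrow> real" where
  "limit_prob F \<equiv> prob {\<omega> \<in> space M. F \<subseteq> limit_aggregate \<omega>}"

lemma box_prob_tendsto:
  assumes "finite F"
  shows "(\<lambda>m. box_prob F {- int m..int m}) \<longlonglongrightarrow> limit_prob F"
proof -
  let ?E = "\<lambda>m. {\<omega> \<in> space M. F \<subseteq> aggregate (\<lambda>i j. S i j \<omega>) (L m \<omega>)}"
  have "incseq ?E"
    using aggregate_L_incseq by (auto simp: incseq_def) blast
  moreover have "?E m \<in> events" for m
    using pred_subset_aggregate_L[of F m] by (simp add: pred_def)
  ultimately have "(\<lambda>m. prob (?E m)) \<longlonglongrightarrow> prob (\<Union>m. ?E m)"
    by (intro finite_Lim_measure_incseq) auto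
  moreover have "(\<Union>m. ?E m) = {\<omega> \<in> space M. F \<subseteq> limit_aggregate \<omega>}"
    using subset_limit_aggregate_iff[OF assms] by auto
  ultimately show ?thesis by (simp add: prob_subset_aggregate_L)
qed

text \<open>Every finite set of levels, centred or not, lies in a symmetric box, and the box
  probabilities increase to the limit.\<close>

lemma box_prob_le_limit:
  assumes "finite F" "finite I"
  shows "box_prob F I \<le> limit_prob F"
proof -
  have "\<exists>m. I \<subseteq> {- int m..int m}"
  proof -
    have "finite (abs ` I)" using assms by simp
    then obtain b where "\<And>i. i \<in> I \<Longrightarrow> \<bar>i\<bar> \<le> b"
      by (metis bdd_above.E bdd_above_finite imageI)
    then have "I \<subseteq> {- int (nat b)..int (nat b)}" by force
    then show ?thesis by blast
  qed
  then obtain m where m: "I \<subseteq> {- int m..int m}" by blast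
  then have "box_prob F I \<le> box_prob F {- int k..int k}" if "k \<ge> m" for k
    using that by (intro box_prob_mono) force+
  then show ?thesis
    by (intro LIMSEQ_le_const[OF box_prob_tendsto[OF assms(1)]]) blast
qed

lemma finite_translate: "finite F \<Longrightarrow> finite (translate k F)"
  by (simp add: translate_def)

text \<open>A translated box is no longer centred but is still finite, so the limit bounds its
  probability. Applying this also to \<open>- k\<close> yields equality.\<close>

lemma limit_prob_translate_le:
  assumes "finite F"
  shows "limit_prob F \<le> limit_prob (translate k F)"
proof (rule LIMSEQ_le_const2[OF box_prob_tendsto[OF assms]], intro exI allI impI)
  fix m :: nat
  have "box_prob F {- int m..int m} = box_prob (translate k F) ((\<lambda>i. i + k) ` {- int m..int m})"
    by (simp only: box_prob_translate finite_atLeastAtMost_int)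
  also have "\<dots> \<le> limit_prob (translate k F)"
    using assms by (intro box_prob_le_limit finite_translate) auto
  finally show "box_prob F {- int m..int m} \<le> limit_prob (translate k F)" .
qed

lemma limit_prob_translate:
  assumes "finite F"
  shows "limit_prob (translate k F) = limit_prob F"
proof (rule antisym)
  have "translate (- k) (translate k F) = F"
    using translate_translate_uminus[of "- k"] by simp
  then show "limit_prob (translate k F) \<le> limit_prob F"
    using limit_prob_translate_le[of "translate k F" "- k"] assms finite_translate by simp
qed (rule limit_prob_translate_le[OF assms])

text \<open>For such \<open>k\<close> the box and its translate are disjoint. Both bounds are free
  of \<open>k\<close>, because translation changes neither the box nor the limit
  probabilities.\<close>

lemma limit_prob_Un_bounds:
  assumes "finite F" "finite G" and k: "\<bar>k\<bar> > 2 * int m"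
  defines "I \<equiv> {- int m..int m}"
  shows "box_prob F I * box_prob G I \<le> limit_prob (F \<union> translate k G)"
    and "limit_prob (F \<union> translate k G) \<le> box_prob F I * box_prob G I
      + (limit_prob F - box_prob F I) + (limit_prob G - box_prob G I)"
proof -
  let ?J = "(\<lambda>i. i + k) ` I" and ?G = "translate k G"
  have fin: "finite ?G" "finite (F \<union> ?G)" "finite I" using assms finite_translate by auto
  have J: "box_prob ?G ?J = box_prob G I" by (rule box_prob_translate[OF fin(3)])
  have disj: "I \<inter> ?J = {}" using k by (auto simp: I_def)
  have "box_prob F I * box_prob ?G ?J \<le> box_prob (F \<union> ?G) (I \<union> ?J)"
    using fin disj by (intro box_prob_Un_bounds(1)) auto
  also have "\<dots> \<le> limit_prob (F \<union> ?G)" using fin by (intro box_prob_le_limit) auto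
  finally show "box_prob F I * box_prob G I \<le> limit_prob (F \<union> ?G)" by (simp add: J)
  show "limit_prob (F \<union> ?G) \<le> box_prob F I * box_prob G I
      + (limit_prob F - box_prob F I) + (limit_prob G - box_prob G I)"
  \<comment> \<open>From the size \<open>m + nat \<bar>k\<bar>\<close> on, a centred box contains
    both \<open>I\<close> and its translate.\<close>
  proof (rule LIMSEQ_le_const2[OF box_prob_tendsto[OF fin(2)]], intro exI[of _ "m + nat \<bar>k\<bar>"] allI impI)
    fix l assume l: "m + nat \<bar>k\<bar> \<le> l"
    let ?K = "{- int l..int l}"
    have "I \<union> ?J \<subseteq> ?K" using l by (auto simp: I_def)
    then have "box_prob (F \<union> ?G) ?K \<le> box_prob F I * box_prob ?G ?J
        + (box_prob F ?K - box_prob F I) + (box_prob ?G ?K - box_prob ?G ?J)"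
      using disj by (intro box_prob_Un_bounds(2)) auto
    moreover have "box_prob F ?K \<le> limit_prob F" "box_prob ?G ?K \<le> limit_prob G"
      using box_prob_le_limit[OF assms(1), of ?K] box_prob_le_limit[OF fin(1), of ?K]
        limit_prob_translate[OF assms(2)] by auto
    ultimately show "box_prob (F \<union> ?G) ?K \<le> box_prob F I * box_prob G I
        + (limit_prob F - box_prob F I) + (limit_prob G - box_prob G I)"
      by (simp add: J)
  qed
qed

text \<open>A box size \<open>m\<close> is fixed first so that both bounds are within
  \<open>e\<close> of the product; then every \<open>k\<close> with
  \<open>\<bar>k\<bar> \<ge> 2 * int m + 1\<close> works.\<close>

lemma limit_prob_mixing:
  assumes "finite F" "finite G"
  shows "((\<lambda>k. limit_prob (F \<union> translate k G)) \<longlongrightarrow> limit_prob F * limit_prob G) (filtercomap abs at_top)"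
proof (rule tendstoI)
  fix e :: real assume "e > 0"
  let ?q = "\<lambda>F m. box_prob F {- int m..int m}"
  have "(\<lambda>m. ?q F m * ?q G m + (limit_prob F - ?q F m) + (limit_prob G - ?q G m)) \<longlonglongrightarrow>
      limit_prob F * limit_prob G + (limit_prob F - limit_prob F) + (limit_prob G - limit_prob G)"
    by (intro tendsto_intros box_prob_tendsto assms)
  then have "\<forall>\<^sub>F m in sequentially. ?q F m * ?q G m + (limit_prob F - ?q F m) + (limit_prob G - ?q G m)
      < limit_prob F * limit_prob G + e"
    by (rule order_tendstoD) (use \<open>e > 0\<close> in simp)
  moreover have "(\<lambda>m. ?q F m * ?q G m) \<longlonglongrightarrow> limit_prob F * limit_prob G"
    by (intro tendsto_intros box_prob_tendsto assms)
  then have "\<forall>\<^sub>F m in sequentially. limit_prob F * limit_prob G - e < ?q F m * ?q G m"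
    by (rule order_tendstoD) (use \<open>e > 0\<close> in simp)
  ultimately have "\<forall>\<^sub>F m in sequentially.
      ?q F m * ?q G m + (limit_prob F - ?q F m) + (limit_prob G - ?q G m) < limit_prob F * limit_prob G + e
      \<and> limit_prob F * limit_prob G - e < ?q F m * ?q G m"
    by (rule eventually_conj)
  then obtain m where m:
      "?q F m * ?q G m + (limit_prob F - ?q F m) + (limit_prob G - ?q G m) < limit_prob F * limit_prob G + e"
      "limit_prob F * limit_prob G - e < ?q F m * ?q G m"
    by (metis (mono_tags, lifting) eventually_happens sequentially_bot)
  have "dist (limit_prob (F \<union> translate k G)) (limit_prob F * limit_prob G) < e"
    if "\<bar>k\<bar> \<ge> 2 * int m + 1" for k
    using limit_prob_Un_bounds[OF assms, of m k] m that by (simp add: dist_real_def abs_less_iff)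
  then show "\<forall>\<^sub>F k in filtercomap abs at_top. dist (limit_prob (F \<union> translate k G)) (limit_prob F * limit_prob G) < e"
    unfolding eventually_filtercomap_at_top_linorder by blast
qed

lemma vertically_mixing: "vertically_mixing M limit_aggregate"
proof (rule vertically_mixingI)
  show "limit_aggregate \<in> M \<rightarrow>\<^sub>M config_space"
  proof (rule measurable_config_spaceI)
    fix z
    have [measurable]: "Measurable.pred M (\<lambda>\<omega>. z \<in> aggregate (\<lambda>i j. S i j \<omega>) (L m \<omega>))" for m
      using pred_subset_aggregate_L[of "{z}" m] by simp
    show "Measurable.pred M (\<lambda>\<omega>. z \<in> limit_aggregate \<omega>)" by simp
  qed
qed (rule limit_prob_translate limit_prob_mixing; assumption)+

end

section \<open>The three aggregates\<close>

lemma usual_order_Suc: "usual_order (Suc m) = usual_order m @ [int (Suc m), - int (Suc m)]"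
  by (simp add: usual_order_def)

lemma set_usual_order: "set (usual_order m) = {- int m..int m}"
proof (induction m)
  case (Suc m)
  then show ?case by (auto simp: usual_order_Suc)
qed (simp add: usual_order_def)

lemma distinct_usual_order: "distinct (usual_order m)"
proof (induction m)
  case (Suc m)
  then show ?case by (auto simp: usual_order_Suc set_usual_order)
qed (simp add: usual_order_def)

lemma set_level_by_level: "set (level_by_level c m) = particles c {- int m..int m}"
  unfolding level_by_level_def particles_def set_concat set_map set_usual_order set_upt
    atLeastLessThanSuc_atLeastAtMost by (auto simp: image_iff)

lemma distinct_level_by_level: "distinct (level_by_level c m)"
proof -
  have "distinct (concat (map (\<lambda>i. map (\<lambda>j. (i, j)) [1..<Suc (c i)]) is))" if "distinct is" for "is"
    using that by (induction "is") (auto simp: distinct_map inj_on_def)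
  then show ?thesis by (simp add: level_by_level_def distinct_usual_order)
qed

lemma level_by_level_Suc: "\<exists>ys. level_by_level c (Suc m) = level_by_level c m @ ys"
  by (simp add: level_by_level_def usual_order_Suc)

lemma subseq_level_by_level: "subseq (level_by_level c m) (level_by_level c (Suc m))"
  using level_by_level_Suc[of c m] by (auto intro: prefix_imp_subseq)

text \<open>The list reads only the finitely many counts of its box, which reduces its measurability
  to a finite discrete product.\<close>

lemma level_by_level_restrict: "level_by_level (restrict c {- int m..int m}) m = level_by_level c m"
  unfolding level_by_level_def
  by (intro arg_cong[where f = concat] map_cong) (auto simp: set_usual_order)

lemma measurable_level_by_level:
  assumes "\<And>i. c i \<in> N \<rightarrow>\<^sub>M count_space UNIV"
  shows "(\<lambda>\<omega>. level_by_level (\<lambda>i. c i \<omega>) m) \<in> N \<rightarrow>\<^sub>M count_space UNIV"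
proof -
  let ?I = "{- int m..int m}"
  have "(\<lambda>\<omega>. restrict (\<lambda>i. c i \<omega>) ?I) \<in> N \<rightarrow>\<^sub>M PiM ?I (\<lambda>_. count_space UNIV)"
    by (intro measurable_restrict assms)
  moreover have "(\<lambda>d. level_by_level d m) \<in> PiM ?I (\<lambda>_. count_space UNIV) \<rightarrow>\<^sub>M count_space UNIV"
    by (simp add: count_space_PiM_finite)
  ultimately have "(\<lambda>\<omega>. level_by_level (restrict (\<lambda>i. c i \<omega>) ?I) m) \<in> N \<rightarrow>\<^sub>M count_space UNIV"
    by (rule measurable_compose)
  then show ?thesis by (simp only: level_by_level_restrict)
qed

lemma measurable_vimage_algebra_component:
  assumes "\<And>i. i \<in> I \<Longrightarrow> X i \<in> \<Omega> \<rightarrow> space K" "i \<in> I"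
  shows "X i \<in> vimage_algebra \<Omega> (\<lambda>\<omega>. \<lambda>i\<in>I. X i \<omega>) (PiM I (\<lambda>_. K)) \<rightarrow>\<^sub>M K"
proof -
  have "(\<lambda>\<omega>. \<lambda>i\<in>I. X i \<omega>) \<in> \<Omega> \<rightarrow> space (PiM I (\<lambda>_. K))"
    using assms(1) by (auto simp: space_PiM Pi_iff)
  from measurable_compose[OF measurable_vimage_algebra1[OF this] measurable_component_singleton[OF assms(2)]]
  show ?thesis using assms(2) by simp
qed

text \<open>Quantifying over all \<open>N\<close> that make the \<open>Y j\<close> measurable
  expresses that \<open>L\<close> is determined measurably by \<open>Y\<close>; the instance used is
  the sigma-algebra generated by \<open>Y\<close>.\<close>

lemma (in walks) indep_families_list:
  assumes indep: "indep_families M particle_indices (\<lambda>(i, j). S i j) path_space J Y K"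
    and L: "\<And>N. space N = space M \<Longrightarrow> (\<And>j. j \<in> J \<Longrightarrow> Y j \<in> N \<rightarrow>\<^sub>M K) \<Longrightarrow> L \<in> N \<rightarrow>\<^sub>M count_space UNIV"
    and Y: "\<And>j. j \<in> J \<Longrightarrow> Y j \<in> M \<rightarrow>\<^sub>M K"
    and l: "set l \<subseteq> particle_indices"
  shows "prob {\<omega> \<in> space M. L \<omega> = l \<and> F \<subseteq> aggregate (\<lambda>i j. S i j \<omega>) l} =
    prob {\<omega> \<in> space M. L \<omega> = l} * prob {\<omega> \<in> space M. F \<subseteq> aggregate (\<lambda>i j. S i j \<omega>) l}"
proof -
  let ?V = "vimage_algebra (space M) (\<lambda>\<omega>. \<lambda>j\<in>J. Y j \<omega>) (PiM J (\<lambda>_. K))"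
  let ?W = "vimage_algebra (space M) (\<lambda>\<omega>. \<lambda>p\<in>particle_indices. walk_at \<omega> p) (PiM particle_indices (\<lambda>_. path_space))"
  have "L \<in> ?V \<rightarrow>\<^sub>M count_space UNIV"
    by (rule L) (auto intro!: measurable_vimage_algebra_component dest: measurable_space[OF Y])
  from measurable_sets[OF this, of "{l}"] have V: "{\<omega> \<in> space M. L \<omega> = l} \<in> sets ?V"
    by (simp add: vimage_def Int_def conj_commute)
  have "(\<lambda>\<omega>. walk_at \<omega> p t) \<in> ?W \<rightarrow>\<^sub>M count_space UNIV" if "p \<in> particle_indices" for p t
    using that measurable_space[OF walk_at_measurable]
    by (intro measurable_compose[OF measurable_vimage_algebra_component[where X = "\<lambda>p \<omega>. walk_at \<omega> p"]
          measurable_path_space_component]) auto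
  then have W: "{\<omega> \<in> space M. F \<subseteq> aggregate (\<lambda>i j. S i j \<omega>) l} \<in> sets ?W"
    using pred_subset_grow[of l walk_at ?W F] l unfolding aggregate_eq
    by (auto simp: pred_def)
  have "indep_set (sets ?W) (sets ?V)"
    using indep by (simp add: indep_families_def split_def)
  from indep_setD[OF this W V] show ?thesis
    by (simp add: Int_def conj_ac mult.commute)
qed

text \<open>Constants generate only trivial events. This lets the deterministic count
  \<open>n\<close> enter the frame of random counts.\<close>

lemma (in prob_space) indep_vars_const:
  assumes "\<And>i. i \<in> I \<Longrightarrow> a i \<in> space (N i)"
  shows "indep_vars N (\<lambda>i _. a i) I"
  unfolding indep_vars_def2 indep_sets_def
proof (intro conjI ballI allI impI)
  fix J A assume J: "J \<subseteq> I" "J \<noteq> {}" "finite J"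
    and A: "A \<in> Pi J (\<lambda>i. {(\<lambda>_. a i) -` B \<inter> space M | B. B \<in> sets (N i)})"
  have cases: "A i = {} \<or> A i = space M" if "i \<in> J" for i
  proof -
    from Pi_mem[OF A that] obtain B where "A i = (\<lambda>_. a i) -` B \<inter> space M" by (elim CollectE exE conjE)
    then show ?thesis by (cases "a i \<in> B") (simp_all add: vimage_def)
  qed
  show "prob (\<Inter>i\<in>J. A i) = (\<Prod>i\<in>J. prob (A i))"
  proof (cases "\<exists>i\<in>J. A i = {}")
    case True
    then have "(\<Inter>i\<in>J. A i) = {}" by blast
    moreover have "(\<Prod>i\<in>J. prob (A i)) = 0" using True J(3) by (metis measure_empty prod_zero_iff)
    ultimately show ?thesis by simp
  next
    case False
    then have "A i = space M" if "i \<in> J" for i using cases[OF that] that by auto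
    then show ?thesis using J by (simp add: prob_space)
  qed
qed (use assms in auto)

lemma (in walks) vertically_mixing_A_inf: "vertically_mixing M (A_inf S n)"
proof -
  interpret random_aggregate M S "\<lambda>_ _. n" "\<lambda>m _. level_by_level (\<lambda>_. n) m"
  proof unfold_locales
    show "prob {\<omega> \<in> space M. level_by_level (\<lambda>_. n) m = l \<and> F \<subseteq> aggregate (\<lambda>i j. S i j \<omega>) l} =
        prob {\<omega> \<in> space M. level_by_level (\<lambda>_. n) m = l} * prob {\<omega> \<in> space M. F \<subseteq> aggregate (\<lambda>i j. S i j \<omega>) l}"
      for m l F
      by (cases "level_by_level (\<lambda>_. n) m = l") (simp_all add: prob_space)
  qed (simp_all add: indep_vars_const distinct_level_by_level set_level_by_level subseq_level_by_level)
  show ?thesis using vertically_mixing by (simp add: A_inf_def[abs_def])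
qed

lemma (in walks) vertically_mixing_A_star_inf:
  assumes N: "iid_poisson M r N"
    and indep: "indep_families M particle_indices (\<lambda>(i, j). S i j) path_space UNIV N (count_space UNIV)"
  shows "vertically_mixing M (A_star_inf S N)"
proof -
  have N_measurable: "N i \<in> M \<rightarrow>\<^sub>M count_space UNIV" for i
    using N by (auto simp: iid_poisson_def indep_vars_def2)
  interpret random_aggregate M S N "\<lambda>m \<omega>. level_by_level (\<lambda>i. N i \<omega>) m"
  proof unfold_locales
    show "indep_vars (\<lambda>_. count_space UNIV) N UNIV"
      and "distr M (count_space UNIV) (N i) = distr M (count_space UNIV) (N 0)" for i
      using N by (simp_all add: iid_poisson_def)
    show "prob {\<omega> \<in> space M. level_by_level (\<lambda>i. N i \<omega>) m = l \<and> F \<subseteq> aggregate (\<lambda>i j. S i j \<omega>) l} =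
        prob {\<omega> \<in> space M. level_by_level (\<lambda>i. N i \<omega>) m = l} * prob {\<omega> \<in> space M. F \<subseteq> aggregate (\<lambda>i j. S i j \<omega>) l}"
      if "set l \<subseteq> particle_indices" for l m F
      by (rule indep_families_list[OF indep _ N_measurable that]) (simp add: measurable_level_by_level)
  qed (simp_all add: measurable_level_by_level N_measurable distinct_level_by_level set_level_by_level subseq_level_by_level)
  show ?thesis using vertically_mixing by (simp add: A_star_inf_def[abs_def])
qed

section \<open>Particles sent in order of arrival\<close>

text \<open>A sort key defined on all labels. Listed particles never get the default 0, and
  \<open>j - 1\<close> converts numbering from 1 into list positions.\<close>

definition arrival_time :: "(int \<Rightarrow> real set) \<Rightarrow> real \<Rightarrow> int \<times> nat \<Rightarrow> real" where
  "arrival_time P t = (\<lambda>(i, j). if 1 \<le> j \<and> j \<le> card (P i \<inter> {..t}) then arrivals (P i) t ! (j - 1) else 0)"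

lemma insort_key_map: "insort_key f (h x) (map h xs) = map h (insort_key (\<lambda>x. f (h x)) x xs)"
  by (induction xs) auto

lemma sort_key_map: "sort_key f (map h xs) = map h (sort_key (\<lambda>x. f (h x)) xs)"
  by (induction xs) (auto simp: insort_key_map)

text \<open>Moving the times from the list entries into the key makes the order a rearrangement of
  \<open>level_by_level\<close>, whose content is known.\<close>

lemma by_arrival_eq_sort_key:
  "by_arrival P t m = sort_key (arrival_time P t) (level_by_level (\<lambda>i. card (P i \<inter> {..t})) m)"
proof -
  let ?h = "\<lambda>p. (arrival_time P t p, p)"
  have "timed_particles (P i) t i = map ?h (map (\<lambda>j. (i, j)) [1..<Suc (card (P i \<inter> {..t}))])" for i
    by (auto simp: timed_particles_def arrivals_def arrival_time_def)
  then have "concat (map (\<lambda>i. timed_particles (P i) t i) (usual_order m)) =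
      map ?h (level_by_level (\<lambda>i. card (P i \<inter> {..t})) m)"
    by (simp add: level_by_level_def map_concat comp_def)
  then show ?thesis
    by (simp add: by_arrival_def sort_key_map comp_def)
qed

text \<open>Stable sorting commutes with filtering, and the list of the smaller box is a filter of
  that of the larger one.\<close>

lemma subseq_by_arrival: "subseq (by_arrival P t m) (by_arrival P t (Suc m))"
proof -
  let ?l = "level_by_level (\<lambda>i. card (P i \<inter> {..t}))" and ?f = "arrival_time P t"
  obtain ys where ys: "?l (Suc m) = ?l m @ ys" using level_by_level_Suc by blast
  then have "filter (\<lambda>p. p \<in> set (?l m)) (?l (Suc m)) = ?l m"
    using distinct_level_by_level[of "\<lambda>i. card (P i \<inter> {..t})" "Suc m"] by (auto simp: filter_empty_conv)
  then have "sort_key ?f (?l m) = filter (\<lambda>p. p \<in> set (?l m)) (sort_key ?f (?l (Suc m)))"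
    by (simp add: filter_sort)
  then show ?thesis by (simp add: by_arrival_eq_sort_key)
qed

section \<open>Measurability of the order of arrival\<close>

lemma space_point_space: "space point_space = locally_finite"
  by (simp add: point_space_def space_measure_of_conv)

lemma measurable_card_point_space:
  assumes "B \<in> bounded_borel"
  shows "(\<lambda>C. card (C \<inter> B)) \<in> point_space \<rightarrow>\<^sub>M count_space UNIV"
proof -
  have "(\<lambda>C. card (C \<inter> B)) -` {k} \<inter> space point_space \<in> sets point_space" for k
  proof -
    have "(\<lambda>C. card (C \<inter> B)) -` {k} \<inter> space point_space = {C \<in> locally_finite. card (C \<inter> B) = k}"
      by (auto simp: space_point_space)
    then show ?thesis
      unfolding point_space_def using assms by (subst sets_measure_of) (auto intro!: sigma_sets.Basic)
  qed
  then show ?thesis by (simp add: measurable_count_space_eq_countable)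
qed

lemma atLeastAtMost_bounded_borel: "{0..s} \<in> bounded_borel"
  by (auto simp: bounded_borel_def)

lemma locally_finite_Int_atMost: "C \<in> locally_finite \<Longrightarrow> C \<inter> {..s} = C \<inter> {0..s}"
  by (auto simp: locally_finite_def)

text \<open>The half-line is not in \<open>bounded_borel\<close>; since all points are nonnegative,
  \<open>{0..s}\<close> catches the same ones.\<close>

lemma measurable_card_atMost:
  "(\<lambda>C. card (C \<inter> {..s})) \<in> point_space \<rightarrow>\<^sub>M count_space UNIV"
  using measurable_card_point_space[OF atLeastAtMost_bounded_borel[of s]]
  by (subst measurable_cong[where g = "\<lambda>C. card (C \<inter> {0..s})"])
    (auto simp: space_point_space locally_finite_Int_atMost)

lemma sorted_nth_le_iff:
  fixes xs :: "'a :: linorder list"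
  assumes "sorted xs" "distinct xs" "k < length xs"
  shows "xs ! k \<le> x \<longleftrightarrow> k < card {y \<in> set xs. y \<le> x}"
proof
  assume "xs ! k \<le> x"
  have "set (take (Suc k) xs) \<subseteq> {y \<in> set xs. y \<le> x}"
  proof
    fix y assume "y \<in> set (take (Suc k) xs)"
    then obtain i where i: "i \<le> k" "y = xs ! i" by (auto simp: in_set_conv_nth less_Suc_eq_le)
    then have "y \<le> xs ! k" using sorted_nth_mono[OF assms(1) i(1) assms(3)] by simp
    with i \<open>xs ! k \<le> x\<close> show "y \<in> {y \<in> set xs. y \<le> x}" using assms(3) by auto
  qed
  then have "card (set (take (Suc k) xs)) \<le> card {y \<in> set xs. y \<le> x}"
    by (intro card_mono) auto
  then show "k < card {y \<in> set xs. y \<le> x}"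
    using assms by (simp add: distinct_card)
next
  assume k: "k < card {y \<in> set xs. y \<le> x}"
  show "xs ! k \<le> x"
  proof (rule ccontr)
    assume "\<not> xs ! k \<le> x"
    have "{y \<in> set xs. y \<le> x} \<subseteq> set (take k xs)"
    proof
      fix y assume "y \<in> {y \<in> set xs. y \<le> x}"
      then obtain i where i: "i < length xs" "y = xs ! i" "xs ! i \<le> x"
        by (auto simp: in_set_conv_nth)
      then have "i < k"
        using sorted_nth_mono[OF assms(1), of k i] \<open>\<not> xs ! k \<le> x\<close> by (meson not_le order_trans)
      then show "y \<in> set (take k xs)"
        using i assms by (auto simp: in_set_conv_nth)
    qed
    then have "card {y \<in> set xs. y \<le> x} \<le> card (set (take k xs))" by (intro card_mono) auto
    also have "\<dots> \<le> k" using card_length[of "take k xs"] by simp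
    finally show False using k by simp
  qed
qed

text \<open>Expresses arrival times through counts of points, whose level sets generate
  \<open>point_space\<close>.\<close>

lemma arrivals_nth_le_iff:
  assumes "C \<in> locally_finite" "1 \<le> j" "j \<le> card (C \<inter> {..t})"
  shows "arrivals C t ! (j - 1) \<le> a \<longleftrightarrow> j \<le> card (C \<inter> {..min a t})"
proof -
  have "finite (C \<inter> {..t})" using assms by (simp add: locally_finite_def)
  moreover have "{y \<in> C \<inter> {..t}. y \<le> a} = C \<inter> {..min a t}" by auto
  ultimately show ?thesis
    using sorted_nth_le_iff[of "arrivals C t" "j - 1" a] assms by (auto simp: arrivals_def)
qed

lemma measurable_arrival_time:
  assumes P: "\<And>i. P i \<in> N \<rightarrow>\<^sub>M point_space"
  shows "(\<lambda>\<omega>. arrival_time (\<lambda>i. P i \<omega>) t p) \<in> borel_measurable N"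
proof -
  obtain i j where p: "p = (i, j)" by force
  have [measurable]: "(\<lambda>\<omega>. card (P i \<omega> \<inter> {..s})) \<in> N \<rightarrow>\<^sub>M count_space UNIV" for s
    by (rule measurable_compose[OF P measurable_card_atMost])
  have lf: "P i \<omega> \<in> locally_finite" if "\<omega> \<in> space N" for \<omega>
    using measurable_space[OF P that] by (simp add: space_point_space)
  show ?thesis
    unfolding borel_measurable_iff_le
  proof
    fix a
    have "{\<omega> \<in> space N. arrival_time (\<lambda>i. P i \<omega>) t p \<le> a} =
      {\<omega> \<in> space N. if 1 \<le> j \<and> j \<le> card (P i \<omega> \<inter> {..t}) then j \<le> card (P i \<omega> \<inter> {..min a t}) else 0 \<le> a}"
      using arrivals_nth_le_iff[OF lf, of _ j t a] by (auto simp: p arrival_time_def)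
    also have "\<dots> \<in> sets N" by measurable
    finally show "{\<omega> \<in> space N. arrival_time (\<lambda>i. P i \<omega>) t p \<le> a} \<in> sets N" .
  qed
qed

lemma measurable_insort_key:
  fixes f :: "'a \<Rightarrow> 'k :: countable \<Rightarrow> real"
  assumes f: "\<And>k. (\<lambda>\<omega>. f \<omega> k) \<in> borel_measurable N"
  shows "(\<lambda>\<omega>. insort_key (f \<omega>) k ks) \<in> N \<rightarrow>\<^sub>M count_space UNIV"
proof (induction ks)
  case (Cons y ks)
  have "(\<lambda>\<omega>. y # insort_key (f \<omega>) k ks) \<in> N \<rightarrow>\<^sub>M count_space UNIV"
    by (rule measurable_compose[OF Cons]) simp
  then have "(\<lambda>\<omega>. if f \<omega> k \<le> f \<omega> y then k # y # ks else y # insort_key (f \<omega>) k ks) \<in> N \<rightarrow>\<^sub>M count_space UNIV"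
    by (intro measurable_If borel_measurable_le f) simp_all
  then show ?case by simp
qed simp

lemma measurable_sort_key:
  fixes f :: "'a \<Rightarrow> 'k :: countable \<Rightarrow> real"
  assumes f: "\<And>k. (\<lambda>\<omega>. f \<omega> k) \<in> borel_measurable N"
  shows "(\<lambda>\<omega>. sort_key (f \<omega>) ks) \<in> N \<rightarrow>\<^sub>M count_space UNIV"
proof (induction ks)
  case (Cons k ks)
  have "(\<lambda>\<omega>. insort_key (f \<omega>) k (sort_key (f \<omega>) ks)) \<in> N \<rightarrow>\<^sub>M count_space UNIV"
    by (rule measurable_compose_countable[OF measurable_insort_key[OF f] Cons])
  then show ?case by simp
qed simp

text \<open>Both the keys and the list to be sorted are random; as lists are countable, it suffices
  to sort a fixed list with random keys.\<close>

lemma measurable_by_arrival: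
  assumes P: "\<And>i. P i \<in> N \<rightarrow>\<^sub>M point_space"
  shows "(\<lambda>\<omega>. by_arrival (\<lambda>i. P i \<omega>) t m) \<in> N \<rightarrow>\<^sub>M count_space UNIV"
  unfolding by_arrival_eq_sort_key
  by (rule measurable_compose_countable[OF measurable_sort_key[OF measurable_arrival_time[OF P]]
        measurable_level_by_level[OF measurable_compose[OF P measurable_card_atMost]]])

lemma (in walks) vertically_mixing_A_dag_inf:
  assumes P: "iid_poisson_processes M r P"
    and indep: "indep_families M particle_indices (\<lambda>(i, j). S i j) path_space UNIV P point_space"
  shows "vertically_mixing M (A_dag_inf S P n)"
proof -
  let ?c = "\<lambda>i \<omega>. card (P i \<omega> \<inter> {..real n})"
  have P_measurable: "P i \<in> M \<rightarrow>\<^sub>M point_space" for i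
    using P by (auto simp: iid_poisson_processes_def indep_vars_def2)
  interpret random_aggregate M S ?c "\<lambda>m \<omega>. by_arrival (\<lambda>i. P i \<omega>) (real n) m"
  proof unfold_locales
    show "indep_vars (\<lambda>_. count_space UNIV) ?c UNIV"
      using P unfolding iid_poisson_processes_def
      by (auto intro: indep_vars_compose2 measurable_card_atMost)
    \<comment> \<open>The point masses of the count do not involve \<open>i\<close>, so all levels
      have the same law of counts.\<close>
    have "emeasure (distr M (count_space UNIV) (?c i)) {k} =
        (r * measure lborel {0..real n}) ^ k / fact k * exp (- (r * measure lborel {0..real n}))" for i k
    proof -
      have "?c i \<omega> = card (P i \<omega> \<inter> {0..real n})" if "\<omega> \<in> space M" for \<omega>
        using measurable_space[OF P_measurable that]
        by (simp add: space_point_space locally_finite_Int_atMost)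
      then have "?c i -` {k} \<inter> space M = {\<omega> \<in> space M. card (P i \<omega> \<inter> {0..real n}) = k}" by auto
      then show ?thesis
        using P atLeastAtMost_bounded_borel[of "real n"] measurable_compose[OF P_measurable measurable_card_atMost]
        by (subst emeasure_distr)
          (auto simp: emeasure_eq_measure iid_poisson_processes_def poisson_process_def)
    qed
    then show "distr M (count_space UNIV) (?c i) = distr M (count_space UNIV) (?c 0)" for i
      by (intro measure_eqI_countable[where A = UNIV]) auto
    show "prob {\<omega> \<in> space M. by_arrival (\<lambda>i. P i \<omega>) (real n) m = l \<and> F \<subseteq> aggregate (\<lambda>i j. S i j \<omega>) l} =
        prob {\<omega> \<in> space M. by_arrival (\<lambda>i. P i \<omega>) (real n) m = l} * prob {\<omega> \<in> space M. F \<subseteq> aggregate (\<lambda>i j. S i j \<omega>) l}"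
      if "set l \<subseteq> particle_indices" for l m F
      by (rule indep_families_list[OF indep _ P_measurable that]) (simp add: measurable_by_arrival)
  qed (simp_all add: measurable_by_arrival P_measurable subseq_by_arrival,
      simp_all add: by_arrival_eq_sort_key distinct_level_by_level set_level_by_level)
  show ?thesis using vertically_mixing by (simp add: A_dag_inf_def[abs_def])
qed

theorem proposition5p1:
  fixes M :: "'a measure"
    and S :: "int \<Rightarrow> nat \<Rightarrow> 'a \<Rightarrow> nat \<Rightarrow> int \<times> int"
    and n :: nat
  assumes "prob_space M"
    and "independent_walks M S"
    and "n \<ge> 1"
  shows "vertically_mixing M (A_inf S n) \<and>
    (\<forall>N. iid_poisson M (real n) N \<and>
        indep_families M particle_indices (\<lambda>(i, j). S i j) path_space UNIV N (count_space UNIV)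
      \<longrightarrow> vertically_mixing M (A_star_inf S N)) \<and>
    (\<forall>P. iid_poisson_processes M 1 P \<and>
        indep_families M particle_indices (\<lambda>(i, j). S i j) path_space UNIV P point_space
      \<longrightarrow> vertically_mixing M (A_dag_inf S P n))"
proof -
  interpret walks M S
    using assms by (simp add: walks_def walks_axioms_def)
  show ?thesis
    using vertically_mixing_A_inf vertically_mixing_A_star_inf vertically_mixing_A_dag_inf by blast
qed

end
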